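(* Let $\alpha>\beta\geq 0$ be constants, let $n$ be even, and let $p=\frac{\alpha\log n}{n}$ and $q=\frac{\beta\log n}{n}$. Let $G$ be a random graph with $n$ nodes drawn from the stochastic block model on two communities with edge probabilities $p$ and $q$, with adjacency matrix $A$ and true partition encoded by $g\in\{\pm1\}^n$. If $$\sqrt{\alpha}-\sqrt{\beta}>\sqrt2,$$ then, with high probability, the solution of the semidefinite program $$\max\ \mathrm{Tr}\left[\left(2A-(\mathbf{1}\mathbf{1}^T-I)\right)X\right]\quad\text{s.t. } X\in\mathbb{R}^{n\times n}\text{ symmetric},\ X_{ii}=1\text{ for all } i,\ X\succeq0$$ coincides with the true partition, i.e. $X=gg^T$ is its unique optimal solution.
   Context: Stochastic block model with two communities $\mathcal{G}(n,p,q)$ ($n$ even, $0\le p,q\le1$): the $n$ nodes are divided into two clusters of $\frac n2$ nodes each, and each pair of vertices $i\neq j$ is an edge with probability $p$ if they are in the same cluster and $q$ otherwise, independently of all other edges. $g\in\{\pm1\}^n$ is the vector equal to $1$ on one cluster and $-1$ on the other. $\mathbf{1}$ is the all-ones vector. An event $\mathcal{E}$ (depending on $n$) happens with high probability when $\mathbb{P}[\mathcal{E}]=1-n^{-\Omega(1)}$ as $n\to\infty$, i.e. $\mathbb{P}[\mathcal E]\ge 1-n^{-\kappa}$ for some constant $\kappa>0$ and all large $n$. *)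

theory Defs
  imports "HOL-Probability.Product_PMF" "Jordan_Normal_Form.Matrix"
begin

definition balanced_partition :: "nat \<Rightarrow> real vec \<Rightarrow> bool" where
  "balanced_partition n g \<longleftrightarrow>
     g \<in> carrier_vec n \<and>
     (\<forall>i<n. vec_index g i \<in> {1, -1}) \<and>
     2 * card {i. i < n \<and> vec_index g i = 1} = n \<and>
     2 * card {i. i < n \<and> vec_index g i = -1} = n"

text \<open>
  A graph on the nodes \<open>0, \<dots>, n - 1\<close> is represented by its set of edges, each edge being an
  unordered pair of distinct nodes.
\<close>

definition vertex_pairs :: "nat \<Rightarrow> nat set set" where
  "vertex_pairs n = {{i, j} | i j. i < n \<and> j < n \<and> i \<noteq> j}"

definition edge_prob :: "real \<Rightarrow> real \<Rightarrow> real vec \<Rightarrow> nat set \<Rightarrow> real" where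
  "edge_prob p q g e = (if \<forall>i\<in>e. \<forall>j\<in>e. vec_index g i = vec_index g j then p else q)"

text \<open>
  Pitfall: for a parameter outside \<open>[0, 1]\<close>, \<^const>\<open>bernoulli_pmf\<close> truncates it to that interval,
  so this is the stochastic block model only for \<open>0 \<le> p \<le> 1\<close> and \<open>0 \<le> q \<le> 1\<close>.  Probabilities
  of order \<open>ln n / n\<close> satisfy this for all large \<open>n\<close>.
\<close>

definition sbm :: "nat \<Rightarrow> real \<Rightarrow> real \<Rightarrow> real vec \<Rightarrow> nat set set pmf" where
  "sbm n p q g =
     map_pmf Collect (Pi_pmf (vertex_pairs n) False (\<lambda>e. bernoulli_pmf (edge_prob p q g e)))"

definition adjacency_matrix :: "nat \<Rightarrow> nat set set \<Rightarrow> real mat" where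
  "adjacency_matrix n E = Matrix.mat n n (\<lambda>(i, j). if i \<noteq> j \<and> {i, j} \<in> E then 1 else 0)"

definition mat_trace :: "real mat \<Rightarrow> real" where
  "mat_trace M = (\<Sum>i<dim_row M. M $$ (i, i))"

definition outer_prod :: "real vec \<Rightarrow> real vec \<Rightarrow> real mat" where
  "outer_prod u v =
     Matrix.mat (dim_vec u) (dim_vec v) (\<lambda>(i, j). vec_index u i * vec_index v j)"

definition all_ones :: "nat \<Rightarrow> real vec" where
  "all_ones n = Matrix.vec n (\<lambda>_. 1)"

definition sdp_objective :: "nat \<Rightarrow> real mat \<Rightarrow> real mat \<Rightarrow> real" where
  "sdp_objective n A X =
     mat_trace ((2 \<cdot>\<^sub>m A - (outer_prod (all_ones n) (all_ones n) - 1\<^sub>m n)) * X)"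

definition symmetric_psd :: "nat \<Rightarrow> real mat \<Rightarrow> bool" where
  "symmetric_psd n X \<longleftrightarrow>
     X \<in> carrier_mat n n \<and> transpose_mat X = X \<and>
     (\<forall>v\<in>carrier_vec n. 0 \<le> scalar_prod v (X *\<^sub>v v))"

definition sdp_feasible :: "nat \<Rightarrow> real mat \<Rightarrow> bool" where
  "sdp_feasible n X \<longleftrightarrow> symmetric_psd n X \<and> (\<forall>i<n. X $$ (i, i) = 1)"

definition sdp_solutions :: "nat \<Rightarrow> real mat \<Rightarrow> real mat set" where
  "sdp_solutions n A = {X. is_arg_max (sdp_objective n A) (sdp_feasible n) X}"

end

theory Submission
  imports Defs "HOL-Real_Asymp.Real_Asymp"
begin

text \<open>
  Write \<open>A\<close> for the adjacency matrix, \<open>\<gamma>\<close> for the sign vector of the partition, \<open>J\<close> for the all-ones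
  matrix, and call \<open>\<Sum>j. A i j * \<gamma> i * \<gamma> j\<close> the margin of node \<open>i\<close>: its number of neighbours in its own
  cluster minus its number of neighbours in the other one.  With \<open>D\<close> the diagonal matrix of the
  margins, \<open>S = 2 D + J - 2 A\<close> annihilates \<open>\<gamma>\<close>, and on the feasible set the objective is a constant
  minus \<open>Tr (S X)\<close>.  Hence the partition is the only optimum as soon as the quadratic form of \<open>S\<close>
  is positive on the nonzero vectors orthogonal to \<open>\<gamma>\<close> (\<open>sdp_dual_certificate\<close>).  The expectation of
  \<open>A\<close> is \<open>(p + q)/2 J + (p - q)/2 \<gamma> \<gamma>\<^sup>T - p I\<close>, which on such vectors is dominated by \<open>J / 2\<close> when
  \<open>p + q \<le> 1\<close>.  So it suffices that every margin is larger than the largest value of the fluctuation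
  form \<open>x \<mapsto> x\<^sup>T (A - E A) x\<close> on the unit sphere (\<open>sdp_recovery_if_margin_exceeds_fluctuation\<close>).

  Let \<open>d = ln n\<close>.  By an exponential Markov bound, a given margin is below \<open>\<delta> d\<close> with probability
  roughly \<open>n powr (- (sqrt \<alpha> - sqrt \<beta>)\<^sup>2 / 2 + O(\<delta>))\<close>, and the hypothesis on \<open>\<alpha>\<close> and \<open>\<beta>\<close> says that
  this survives a union bound over the nodes for small \<open>\<delta>\<close> (\<open>margin_tail\<close>,
  \<open>chernoff_exponent_below_minus_one\<close>).

  It remains to bound the fluctuation form by \<open>\<epsilon> d\<close> for every fixed \<open>\<epsilon> > 0\<close>; a bound by a large
  constant times \<open>d\<close>, as the matrix Bernstein inequality gives, would not suffice.  Scale \<open>x\<close> to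
  squared norm \<open>n\<close>, call a coordinate heavy if it exceeds \<open>R\<close>, of order \<open>sqrt d\<close>, and fairly large if
  it exceeds \<open>\<eta> R\<close>, with a small constant \<open>\<eta>\<close>.  The pairs of coordinates then fall into three kinds
  (\<open>fluctuation_form_bound\<close>).

    \<^item> Neither is heavy.  Rounding to integer vectors leaves \<open>48 ^ n\<close> candidates for each argument of
      the bilinear form, and bounded coordinates make the exponential tail strong enough for a union
      bound over all of them.

    \<^item> Both are fairly large.  There are at most \<open>O(n / d)\<close> such nodes, and every set of at most so
      many nodes spans only \<open>\<epsilon>' d\<close> edges per node.  A graph with this property has an order in which
      every node has few later neighbours, and its form is then much smaller than its maximal degree.

    \<^item> One is heavy and the other is at most \<open>\<eta>\<close> times as large.  The product is at most \<open>\<eta>\<close> times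
      the larger square, and the maximal degree is \<open>O(d)\<close>.
\<close>

section \<open>Optimality of the partition from a dual certificate\<close>

text \<open>
  Cholesky factorisation: split off the vector built from one column and continue with the Schur
  complement on the remaining indices.  It serves to write the trace of a product with \<open>X\<close> as a sum
  of values of a quadratic form, without eigenvectors.
\<close>
lemma psd_gram_decomposition:
  fixes X :: "'a \<Rightarrow> 'a \<Rightarrow> real"
  assumes "finite I"
    and "\<And>i j. i \<in> I \<Longrightarrow> j \<in> I \<Longrightarrow> X i j = X j i"
    and "\<And>v. 0 \<le> (\<Sum>i\<in>I. \<Sum>j\<in>I. X i j * v i * v j)"
  shows "\<exists>(m::nat) w. \<forall>i\<in>I. \<forall>j\<in>I. X i j = (\<Sum>k<m. w k i * w k j)"
  using assms
proof (induction I arbitrary: X rule: finite_induct)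
  case empty
  then show ?case by simp
next
  case (insert r I)
  note sym = insert.prems(1) and psd = insert.prems(2)
  have quad: "(\<Sum>i\<in>insert r I. \<Sum>j\<in>insert r I. X i j * v i * v j) =
      X r r * (v r)\<^sup>2 + 2 * v r * (\<Sum>i\<in>I. X i r * v i) + (\<Sum>i\<in>I. \<Sum>j\<in>I. X i j * v i * v j)" for v
  proof -
    have "(\<Sum>j\<in>I. X r j * v r * v j) = v r * (\<Sum>j\<in>I. X j r * v j)"
      using sym by (simp add: sum_distrib_left mult_ac)
    moreover have "(\<Sum>i\<in>I. X i r * v i * v r) = v r * (\<Sum>i\<in>I. X i r * v i)"
      by (simp add: sum_distrib_left mult_ac)
    ultimately show ?thesis
      using insert.hyps by (simp add: sum.distrib power2_eq_square)
  qed
  have diag: "0 \<le> X r r"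
  proof -
    define v where "v = (\<lambda>i. if i = r then 1 else (0::real))"
    have v: "v r = 1" "\<And>i. i \<in> I \<Longrightarrow> v i = 0"
      using insert.hyps by (auto simp: v_def)
    have "(\<Sum>i\<in>insert r I. \<Sum>j\<in>insert r I. X i j * v i * v j) = X r r"
      unfolding quad by (simp add: v)
    then show ?thesis using psd[of v] by simp
  qed
  have zero: "X i r = 0" if "X r r = 0" "i \<in> I" for i
  proof (rule ccontr)
    assume nz: "X i r \<noteq> 0"
    have ir: "i \<noteq> r" using that insert.hyps by auto
    \<comment> \<open>the form takes the value \<open>X i i + 2 * t * X i r\<close> at \<open>e\<^sub>i + t e\<^sub>r\<close>; this \<open>t\<close> makes it \<open>-1\<close>\<close>
    define t where "t = - (X i i + 1) / (2 * X i r)"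
    define v where "v = (\<lambda>j. if j = i then 1 else if j = r then t else (0::real))"
    have 1: "(\<Sum>j\<in>I. X j r * v j) = X i r"
    proof -
      have "(\<Sum>j\<in>I. X j r * v j) = (\<Sum>j\<in>I. if j = i then X i r else 0)"
        using insert.hyps by (intro sum.cong) (auto simp: v_def)
      then show ?thesis using that insert.hyps by simp
    qed
    have 2: "(\<Sum>j\<in>I. \<Sum>k\<in>I. X j k * v j * v k) = X i i"
    proof -
      have "(\<Sum>j\<in>I. \<Sum>k\<in>I. X j k * v j * v k) = (\<Sum>j\<in>I. \<Sum>k\<in>I. if k = i then if j = i then X i i else 0 else 0)"
        using insert.hyps by (intro sum.cong) (auto simp: v_def)
      then show ?thesis using that insert.hyps by simp
    qed
    have "0 \<le> X r r * (v r)\<^sup>2 + 2 * v r * X i r + X i i"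
      using psd[of v] by (subst (asm) quad) (simp only: 1 2)
    also have "\<dots> = -1" using that nz ir by (simp add: v_def t_def field_simps)
    finally show False by simp
  qed
  define Y where "Y = (\<lambda>i j. X i j - X i r * X j r / X r r)"
  have "0 \<le> (\<Sum>i\<in>I. \<Sum>j\<in>I. Y i j * v i * v j)" for v
  proof -
    define s where "s = (\<Sum>i\<in>I. X i r * v i)"
    \<comment> \<open>the value at \<open>r\<close> that minimises the form, so that the minimum is the Schur complement form;
      for \<open>X r r = 0\<close> it is \<open>0\<close>, since \<open>x / 0 = 0\<close>, and the column of \<open>r\<close> vanishes\<close>
    define v' where "v' = (\<lambda>i. if i = r then - s / X r r else v i)"
    have v': "v' i = v i" if "i \<in> I" for i using that insert.hyps by (auto simp: v'_def)
    have e1: "(\<Sum>i\<in>I. X i r * v' i) = s" unfolding s_def by (intro sum.cong) (auto simp: v')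
    have e2: "(\<Sum>i\<in>I. \<Sum>j\<in>I. X i j * v' i * v' j) = (\<Sum>i\<in>I. \<Sum>j\<in>I. X i j * v i * v j)"
      by (intro sum.cong refl) (simp add: v')
    have e3: "(\<Sum>i\<in>I. \<Sum>j\<in>I. Y i j * v i * v j) = (\<Sum>i\<in>I. \<Sum>j\<in>I. X i j * v i * v j) - s * s / X r r"
      unfolding s_def sum_product Y_def
      by (simp add: sum_subtractf sum_divide_distrib algebra_simps)
    have "0 \<le> X r r * (v' r)\<^sup>2 + 2 * v' r * s + (\<Sum>i\<in>I. \<Sum>j\<in>I. X i j * v i * v j)"
      using psd[of v'] by (subst (asm) quad) (simp only: e1 e2)
    also have "\<dots> = (\<Sum>i\<in>I. \<Sum>j\<in>I. Y i j * v i * v j)"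
      unfolding e3 by (cases "X r r = 0") (auto simp: v'_def field_simps power2_eq_square)
    finally show ?thesis .
  qed
  moreover have "Y i j = Y j i" if "i \<in> I" "j \<in> I" for i j
    using that sym by (simp add: Y_def)
  ultimately obtain m w where w: "\<And>i j. i \<in> I \<Longrightarrow> j \<in> I \<Longrightarrow> Y i j = (\<Sum>k<m::nat. w k i * w k j)"
    using insert.IH[of Y] by blast
  define w' where "w' = (\<lambda>k i. if k = m then X i r / sqrt (X r r) else if i = r then 0 else w k i)"
  have "X i j = (\<Sum>k<Suc m. w' k i * w' k j)" if "i \<in> insert r I" "j \<in> insert r I" for i j
  proof -
    have last: "w' m i * w' m j = X i r * X j r / X r r"
      using diag by (simp add: w'_def)
    have "(\<Sum>k<m. w' k i * w' k j) = (\<Sum>k<m. if i = r \<or> j = r then 0 else w k i * w k j)"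
      by (intro sum.cong) (auto simp: w'_def)
    moreover have "X i j = X i r * X j r / X r r" if "i = r \<or> j = r"
      using that zero \<open>i \<in> insert r I\<close> \<open>j \<in> insert r I\<close> sym[of i j]
      by (cases "X r r = 0") auto
    moreover have "X i j = (\<Sum>k<m. w k i * w k j) + X i r * X j r / X r r" if "\<not> (i = r \<or> j = r)"
      using that w[of i j] \<open>i \<in> insert r I\<close> \<open>j \<in> insert r I\<close> by (simp add: Y_def)
    ultimately show ?thesis by (cases "i = r \<or> j = r") (simp_all add: last)
  qed
  then show ?case by blast
qed

lemma sdp_objective_eq_sum:
  assumes "X \<in> carrier_mat n n"
  shows "sdp_objective n (Matrix.mat n n (\<lambda>(i, j). a i j)) X =
    (\<Sum>i<n. \<Sum>j<n. (2 * a i j - 1 + (if i = j then 1 else 0)) * X $$ (j, i))"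
  using assms
  by (auto simp: sdp_objective_def mat_trace_def outer_prod_def all_ones_def scalar_prod_def
      lessThan_atLeast0 intro!: sum.cong)

lemma quadratic_form_eq_sum:
  fixes v :: "nat \<Rightarrow> real"
  assumes "X \<in> carrier_mat n n"
  shows "scalar_prod (Matrix.vec n v) (X *\<^sub>v Matrix.vec n v) =
    (\<Sum>i<n. \<Sum>j<n. X $$ (i, j) * v i * v j)"
  using assms
  by (auto simp: scalar_prod_def lessThan_atLeast0 sum_distrib_left mult_ac intro!: sum.cong)

lemma balanced_partition_signs:
  assumes "balanced_partition n g"
  shows "\<And>i. i < n \<Longrightarrow> vec_index g i * vec_index g i = 1"
    and "(\<Sum>i<n. vec_index g i) = 0"
proof -
  have s: "\<And>i. i < n \<Longrightarrow> vec_index g i = 1 \<or> vec_index g i = -1"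
    using assms by (auto simp: balanced_partition_def)
  show "\<And>i. i < n \<Longrightarrow> vec_index g i * vec_index g i = 1"
    using s by fastforce
  have "(\<Sum>i<n. vec_index g i) = (\<Sum>i<n. (if vec_index g i = 1 then 1 else 0) - (if vec_index g i = -1 then 1 else 0))"
    using s by (intro sum.cong refl) fastforce
  also have "\<dots> = real (card {i. i < n \<and> vec_index g i = 1}) - real (card {i. i < n \<and> vec_index g i = -1})"
    by (simp add: sum_subtractf sum.If_cases Int_def)
  also have "\<dots> = 0"
    using assms by (auto simp: balanced_partition_def)
  finally show "(\<Sum>i<n. vec_index g i) = 0" .
qed

text \<open>
  Weak duality with the multiplier matrix \<open>s\<close>, whose diagonal part is chosen so that \<open>s\<close> annihilates the
  sign vector.  The objective of a feasible \<open>X\<close> falls short of the value \<open>top\<close> by the sum of the form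
  \<open>q\<close> over the Gram vectors of \<open>X\<close>.  Equality forces each Gram vector to be a multiple of the sign
  vector, and the unit diagonal then fixes \<open>X\<close>.
\<close>
lemma sdp_dual_certificate:
  fixes a :: "nat \<Rightarrow> nat \<Rightarrow> real"
  assumes g: "balanced_partition n g" and n: "n > 0"
    and sym: "\<And>i j. a i j = a j i"
    and pos: "\<And>x. (\<Sum>i<n. vec_index g i * x i) = 0 \<Longrightarrow> \<exists>i<n. x i \<noteq> 0 \<Longrightarrow>
      0 < 2 * (\<Sum>i<n. (\<Sum>j<n. a i j * vec_index g i * vec_index g j) * (x i)\<^sup>2)
        - 2 * (\<Sum>i<n. \<Sum>j<n. a i j * x i * x j) + (\<Sum>i<n. x i)\<^sup>2"
  shows "sdp_solutions n (Matrix.mat n n (\<lambda>(i, j). a i j)) = {outer_prod g g}"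
proof -
  define \<gamma> where "\<gamma> = vec_index g"
  have sq: "\<gamma> i * \<gamma> i = 1" if "i < n" for i
    using balanced_partition_signs(1)[OF g that] by (simp add: \<gamma>_def)
  have bal: "(\<Sum>i<n. \<gamma> i) = 0"
    using balanced_partition_signs(2)[OF g] by (simp add: \<gamma>_def)
  have dim: "dim_vec g = n" using g by (auto simp: balanced_partition_def)
  define c where "c = (\<lambda>i. \<Sum>j<n. a i j * \<gamma> i * \<gamma> j)"
  define s where "s = (\<lambda>i j. (if i = j then 2 * c i else 0) + 1 - 2 * a i j)"
  define q where "q = (\<lambda>x. \<Sum>i<n. \<Sum>j<n. s i j * x i * x j)"
  have s_sym: "s i j = s j i" for i j by (simp add: s_def sym)
  have s_kernel: "(\<Sum>j<n. s i j * \<gamma> j) = 0" if "i < n" for i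
  proof -
    have "(\<Sum>j<n. s i j * \<gamma> j) = (\<Sum>j<n. (if i = j then 2 * c i * \<gamma> i else 0) + \<gamma> j - 2 * (a i j * \<gamma> j))"
      by (intro sum.cong) (auto simp: s_def algebra_simps)
    also have "\<dots> = 2 * c i * \<gamma> i - 2 * (\<Sum>j<n. a i j * \<gamma> j)"
      using that by (simp add: sum.distrib sum_subtractf bal sum_distrib_left)
    also have "2 * c i * \<gamma> i = 2 * (\<Sum>j<n. a i j * \<gamma> j)"
    proof -
      have "c i * \<gamma> i = (\<gamma> i * \<gamma> i) * (\<Sum>j<n. a i j * \<gamma> j)"
        by (simp add: c_def sum_distrib_left sum_distrib_right mult_ac)
      then show ?thesis by (simp add: sq that)
    qed
    finally show ?thesis by simp
  qed
  have q_eq: "q x = 2 * (\<Sum>i<n. c i * (x i)\<^sup>2) - 2 * (\<Sum>i<n. \<Sum>j<n. a i j * x i * x j) + (\<Sum>i<n. x i)\<^sup>2" for x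
  proof -
    have "q x = (\<Sum>i<n. \<Sum>j<n. (if i = j then 2 * (c i * (x i)\<^sup>2) else 0) + x i * x j - 2 * (a i j * x i * x j))"
      unfolding q_def by (intro sum.cong) (auto simp: s_def algebra_simps power2_eq_square)
    also have "\<dots> = (\<Sum>i<n. 2 * (c i * (x i)\<^sup>2)) + (\<Sum>i<n. x i)\<^sup>2 - 2 * (\<Sum>i<n. \<Sum>j<n. a i j * x i * x j)"
      by (simp add: sum.distrib sum_subtractf power2_eq_square sum_product[of x _ x] sum_distrib_left[of 2])
    finally show ?thesis by (simp add: sum_distrib_left)
  qed
  have q_shift: "q (\<lambda>i. x i + t * \<gamma> i) = q x" for x t
  proof -
    have "q (\<lambda>i. x i + t * \<gamma> i) = (\<Sum>i<n. \<Sum>j<n. s i j * x i * x j + t * (x i * (s i j * \<gamma> j))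
        + t * (x j * (s j i * \<gamma> i)) + t * t * (\<gamma> i * (s i j * \<gamma> j)))"
      unfolding q_def by (intro sum.cong refl) (simp add: s_sym[of _ i for i] algebra_simps)
    also have "\<dots> = q x + t * (\<Sum>i<n. x i * (\<Sum>j<n. s i j * \<gamma> j))
        + t * (\<Sum>j<n. x j * (\<Sum>i<n. s j i * \<gamma> i)) + t * t * (\<Sum>i<n. \<gamma> i * (\<Sum>j<n. s i j * \<gamma> j))"
      unfolding q_def sum.distrib sum_distrib_left
      by (subst (5) sum.swap) simp
    also have "\<dots> = q x" by (simp add: s_kernel)
    finally show ?thesis .
  qed
  have q_cases: "q x > 0 \<or> (\<forall>i<n. x i = (\<Sum>i<n. \<gamma> i * x i) / n * \<gamma> i)" for x
  proof -
    define t where "t = (\<Sum>i<n. \<gamma> i * x i) / n"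
    define y where "y = (\<lambda>i. x i + (-t) * \<gamma> i)"
    have "(\<Sum>i<n. \<gamma> i * y i) = (\<Sum>i<n. \<gamma> i * x i - t * (\<gamma> i * \<gamma> i))"
      by (simp add: y_def algebra_simps)
    also have "\<dots> = (\<Sum>i<n. \<gamma> i * x i) - t * n"
      by (simp add: sum_subtractf sq flip: sum_distrib_left)
    also have "\<dots> = 0" using n by (simp add: t_def)
    finally have "q y > 0 \<or> (\<forall>i<n. y i = 0)"
      using pos[of y] unfolding q_eq c_def \<gamma>_def by blast
    then show ?thesis
      unfolding y_def using q_shift[of x "-t"] by (auto simp: t_def)
  qed
  have q_ge0: "q x \<ge> 0" for x
  proof -
    consider "q x > 0" | "\<exists>t. \<forall>i<n. x i = t * \<gamma> i"
      using q_cases[of x] by blast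
    then show ?thesis
    proof cases
      case 2
      then obtain t where "\<forall>i<n. x i = t * \<gamma> i" by blast
      then have "q x = q (\<lambda>i. 0 + t * \<gamma> i)"
        unfolding q_def by (intro sum.cong) auto
      also have "\<dots> = 0" unfolding q_shift by (simp add: q_def)
      finally show ?thesis by simp
    qed simp
  qed
  define top where "top = (\<Sum>i<n. 2 * c i + 1)"
  have obj: "sdp_objective n (Matrix.mat n n (\<lambda>(i, j). a i j)) X = top - (\<Sum>i<n. \<Sum>j<n. s i j * X $$ (j, i))"
    if "X \<in> carrier_mat n n" "\<And>i. i < n \<Longrightarrow> X $$ (i, i) = 1" for X
  proof -
    have "sdp_objective n (Matrix.mat n n (\<lambda>(i, j). a i j)) X =
      (\<Sum>i<n. \<Sum>j<n. (if i = j then 2 * c i + 1 else 0) - s i j * X $$ (j, i))"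
      unfolding sdp_objective_eq_sum[OF that(1)]
      by (intro sum.cong refl) (auto simp: s_def algebra_simps that(2))
    then show ?thesis by (simp add: sum_subtractf top_def)
  qed
  have X0: "outer_prod g g \<in> carrier_mat n n" "\<And>i j. i < n \<Longrightarrow> j < n \<Longrightarrow> outer_prod g g $$ (i, j) = \<gamma> i * \<gamma> j"
    by (auto simp: outer_prod_def dim \<gamma>_def)
  have feas0: "sdp_feasible n (outer_prod g g)"
  proof -
    have "0 \<le> scalar_prod v (outer_prod g g *\<^sub>v v)" if v: "v \<in> carrier_vec n" for v
    proof -
      have "v = Matrix.vec n (vec_index v)" using v by auto
      then have "scalar_prod v (outer_prod g g *\<^sub>v v) = (\<Sum>i<n. \<Sum>j<n. outer_prod g g $$ (i, j) * vec_index v i * vec_index v j)"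
        using quadratic_form_eq_sum[OF X0(1), of "vec_index v"] by simp
      also have "\<dots> = (\<Sum>i<n. \<gamma> i * vec_index v i)\<^sup>2"
        unfolding power2_eq_square sum_product by (intro sum.cong) (auto simp: X0)
      finally show ?thesis by simp
    qed
    moreover have "transpose_mat (outer_prod g g) = outer_prod g g"
      by (rule eq_matI) (auto simp: outer_prod_def)
    ultimately show ?thesis
      using X0 sq by (auto simp: sdp_feasible_def symmetric_psd_def)
  qed
  have obj0: "sdp_objective n (Matrix.mat n n (\<lambda>(i, j). a i j)) (outer_prod g g) = top"
  proof -
    have "(\<Sum>i<n. \<Sum>j<n. s i j * outer_prod g g $$ (j, i)) = (\<Sum>i<n. \<gamma> i * (\<Sum>j<n. s i j * \<gamma> j))"
      unfolding sum_distrib_left by (intro sum.cong refl) (simp add: X0)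
    also have "\<dots> = 0" by (simp add: s_kernel)
    finally show ?thesis
      using obj[OF X0(1)] sq by (simp add: X0)
  qed
  have main: "sdp_objective n (Matrix.mat n n (\<lambda>(i, j). a i j)) X < top \<or> X = outer_prod g g"
    if X: "sdp_feasible n X" for X
  proof -
    have Xc: "X \<in> carrier_mat n n" and Xt: "transpose_mat X = X" and X1: "\<And>i. i < n \<Longrightarrow> X $$ (i, i) = 1"
      using X by (auto simp: sdp_feasible_def symmetric_psd_def)
    have Xs: "X $$ (i, j) = X $$ (j, i)" if "i < n" "j < n" for i j
      using that Xc arg_cong[OF Xt, of "\<lambda>M. M $$ (j, i)"] by auto
    have "0 \<le> (\<Sum>i<n. \<Sum>j<n. X $$ (i, j) * v i * v j)" for v
      using X unfolding quadratic_form_eq_sum[OF Xc, symmetric]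
      by (auto simp: sdp_feasible_def symmetric_psd_def)
    then obtain m w where "\<forall>i\<in>{..<n}. \<forall>j\<in>{..<n}. X $$ (i, j) = (\<Sum>k<m::nat. w k i * w k j)"
      using psd_gram_decomposition[of "{..<n}" "\<lambda>i j. X $$ (i, j)"] Xs by auto
    then have w: "X $$ (i, j) = (\<Sum>k<m. w k i * w k j)" if "i < n" "j < n" for i j
      using that by auto
    have "(\<Sum>i<n. \<Sum>j<n. s i j * X $$ (j, i)) = (\<Sum>i<n. \<Sum>j<n. \<Sum>k<m. s i j * w k i * w k j)"
      by (intro sum.cong refl) (simp add: w sum_distrib_left mult_ac)
    also have "\<dots> = (\<Sum>k<m. q (w k))"
      unfolding q_def by (simp add: sum.swap[of _ "{..<m}"])
    finally have tr: "sdp_objective n (Matrix.mat n n (\<lambda>(i, j). a i j)) X = top - (\<Sum>k<m. q (w k))"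
      using obj[OF Xc X1] by simp
    show ?thesis
    proof (cases "\<exists>k<m. q (w k) > 0")
      case True
      then have "(\<Sum>k<m. q (w k)) > 0"
        using q_ge0 by (auto intro: sum_pos2)
      then show ?thesis by (simp add: tr)
    next
      case False
      define t where "t = (\<lambda>k. (\<Sum>i<n. \<gamma> i * w k i) / n)"
      have t: "w k i = t k * \<gamma> i" if "k < m" "i < n" for k i
        using q_cases[of "w k"] False that unfolding t_def by blast
      define T where "T = (\<Sum>k<m. t k * t k)"
      have XT: "X $$ (i, j) = T * (\<gamma> i * \<gamma> j)" if "i < n" "j < n" for i j
        using that by (simp add: w t T_def sum_distrib_left mult_ac)
      have "T = 1" using XT[of 0 0] X1[of 0] n sq[of 0] by simp
      then have "X = outer_prod g g"
        using Xc X0 XT by (intro eq_matI) auto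
      then show ?thesis by simp
    qed
  qed
  have "is_arg_max (sdp_objective n (Matrix.mat n n (\<lambda>(i, j). a i j))) (sdp_feasible n) X \<longleftrightarrow> X = outer_prod g g" for X
  proof
    assume "X = outer_prod g g"
    then show "is_arg_max (sdp_objective n (Matrix.mat n n (\<lambda>(i, j). a i j))) (sdp_feasible n) X"
      using feas0 obj0 main by (fastforce simp: is_arg_max_def)
  next
    assume "is_arg_max (sdp_objective n (Matrix.mat n n (\<lambda>(i, j). a i j))) (sdp_feasible n) X"
    then show "X = outer_prod g g"
      using feas0 obj0 main[of X] unfolding is_arg_max_def by fastforce
  qed
  then show ?thesis by (auto simp: sdp_solutions_def)
qed

section \<open>A deterministic bound for the fluctuation form\<close>

text \<open>
  Remove a vertex of degree at most \<open>k\<close>, which exists by averaging, and split its products by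
  \<open>2 x y \<le> l x\<^sup>2 + y\<^sup>2 / l\<close> with the large weight \<open>l\<close> on the removed vertex.  Each vertex pays \<open>l k\<close> once, at
  its removal, and otherwise \<open>1 / l\<close> for each edge.  With maximal degree \<open>\<Delta>\<close> and the best \<open>l\<close> this is
  of order \<open>sqrt (k \<Delta>)\<close>, hence small against \<open>\<Delta>\<close> when \<open>k\<close> is.
\<close>
lemma degenerate_form_bound:
  fixes a :: "'a \<Rightarrow> 'a \<Rightarrow> real" and x :: "'a \<Rightarrow> real" and k l :: real
  assumes "finite U"
    and sym: "\<And>i j. a i j = a j i" and nonneg: "\<And>i j. 0 \<le> a i j" and diag: "\<And>i. a i i = 0"
    and "\<And>S. S \<subseteq> U \<Longrightarrow> S \<noteq> {} \<Longrightarrow> (\<Sum>i\<in>S. \<Sum>j\<in>S. a i j) \<le> k * card S"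
    and l: "l > 0"
  shows "(\<Sum>i\<in>U. \<Sum>j\<in>U. a i j * x i * x j) \<le> (\<Sum>i\<in>U. (l * k + (\<Sum>j\<in>U. a i j) / l) * (x i)\<^sup>2)"
  using assms(1,5)
proof (induction U rule: finite_psubset_induct)
  case (psubset U)
  show ?case
  proof (cases "U = {}")
    case False
    obtain v where v: "v \<in> U" "(\<Sum>j\<in>U. a v j) \<le> k"
    proof (rule ccontr)
      assume "\<not> thesis"
      then have "\<And>i. i \<in> U \<Longrightarrow> k < (\<Sum>j\<in>U. a i j)" using that by force
      then have "(\<Sum>i\<in>U. k) < (\<Sum>i\<in>U. \<Sum>j\<in>U. a i j)"
        using False psubset.hyps by (intro sum_strict_mono) auto
      then show False using psubset.prems[of U] False by (simp add: mult.commute)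
    qed
    define W where "W = U - {v}"
    have W: "finite W" "v \<notin> W" "U = insert v W" using v psubset.hyps by (auto simp: W_def)
    have split: "(\<Sum>i\<in>U. \<Sum>j\<in>U. a i j * x i * x j) =
        (\<Sum>i\<in>W. \<Sum>j\<in>W. a i j * x i * x j) + (\<Sum>j\<in>W. a v j * (2 * x v * x j))"
    proof -
      have "(\<Sum>i\<in>W. a i v * x i * x v) = (\<Sum>j\<in>W. a v j * x v * x j)"
        by (intro sum.cong refl) (simp add: sym[of _ v] mult_ac)
      then have "(\<Sum>i\<in>U. \<Sum>j\<in>U. a i j * x i * x j) =
         (\<Sum>i\<in>W. \<Sum>j\<in>W. a i j * x i * x j) + ((\<Sum>j\<in>W. a v j * x v * x j) + (\<Sum>j\<in>W. a v j * x v * x j))"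
        using W by (simp add: sum.distrib diag)
      also have "(\<Sum>j\<in>W. a v j * x v * x j) + (\<Sum>j\<in>W. a v j * x v * x j) = (\<Sum>j\<in>W. a v j * (2 * x v * x j))"
        unfolding sum.distrib[symmetric] by (intro sum.cong) simp_all
      finally show ?thesis .
    qed
    have amgm: "2 * x v * x j \<le> l * (x v)\<^sup>2 + (x j)\<^sup>2 / l" for j
    proof -
      have "0 \<le> (l * x v - x j)\<^sup>2 / l" using l by simp
      also have "\<dots> = l * (x v)\<^sup>2 + (x j)\<^sup>2 / l - 2 * x v * x j"
        using l by (simp add: power2_eq_square field_simps)
      finally show ?thesis by simp
    qed
    have "(\<Sum>j\<in>W. a v j * (2 * x v * x j)) \<le> (\<Sum>j\<in>W. a v j * (l * (x v)\<^sup>2 + (x j)\<^sup>2 / l))"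
      by (intro sum_mono mult_left_mono amgm nonneg)
    also have "\<dots> = l * (\<Sum>j\<in>W. a v j) * (x v)\<^sup>2 + (\<Sum>j\<in>W. a j v / l * (x j)\<^sup>2)"
      by (simp add: distrib_left sum.distrib sum_distrib_left sum_distrib_right sym[of _ v] mult_ac)
    also have "l * (\<Sum>j\<in>W. a v j) * (x v)\<^sup>2 \<le> l * k * (x v)\<^sup>2"
      using v l W by (intro mult_right_mono mult_left_mono) (simp_all add: diag)
    finally have star: "(\<Sum>j\<in>W. a v j * (2 * x v * x j)) \<le> l * k * (x v)\<^sup>2 + (\<Sum>j\<in>W. a j v / l * (x j)\<^sup>2)"
      by simp
    have IH: "(\<Sum>i\<in>W. \<Sum>j\<in>W. a i j * x i * x j) \<le> (\<Sum>i\<in>W. (l * k + (\<Sum>j\<in>W. a i j) / l) * (x i)\<^sup>2)"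
      using psubset.prems W by (intro psubset.IH) auto
    have "(\<Sum>i\<in>W. (l * k + (\<Sum>j\<in>W. a i j) / l) * (x i)\<^sup>2) + (\<Sum>j\<in>W. a j v / l * (x j)\<^sup>2)
        = (\<Sum>i\<in>W. (l * k + (\<Sum>j\<in>U. a i j) / l) * (x i)\<^sup>2)"
      using W by (simp add: add_divide_distrib algebra_simps flip: sum.distrib)
    moreover have "l * k * (x v)\<^sup>2 \<le> (l * k + (\<Sum>j\<in>U. a v j) / l) * (x v)\<^sup>2"
      using l by (intro mult_right_mono) (auto intro!: divide_nonneg_pos sum_nonneg nonneg)
    ultimately have "(\<Sum>i\<in>U. \<Sum>j\<in>U. a i j * x i * x j) \<le>
        (\<Sum>i\<in>W. (l * k + (\<Sum>j\<in>U. a i j) / l) * (x i)\<^sup>2) + (l * k + (\<Sum>j\<in>U. a v j) / l) * (x v)\<^sup>2"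
      using split star IH by linarith
    also have "\<dots> = (\<Sum>i\<in>U. (l * k + (\<Sum>j\<in>U. a i j) / l) * (x i)\<^sup>2)"
    proof -
      have "(\<Sum>i\<in>U. f i) = (\<Sum>i\<in>W. f i) + f v" for f :: "'a \<Rightarrow> real"
        using W by simp
      then show ?thesis by simp
    qed
    finally show ?thesis .
  qed simp
qed

lemma linear_form_rounding:
  fixes h y :: "nat \<Rightarrow> real"
  shows "\<exists>u :: nat \<Rightarrow> int. (\<forall>i. \<bar>real_of_int (u i)\<bar> \<le> \<bar>y i\<bar> + 1) \<and>
    (\<Sum>i<n. h i * y i) \<le> (\<Sum>i<n. h i * u i)"
proof -
  define u where "u = (\<lambda>i. if h i \<ge> 0 then \<lceil>y i\<rceil> else \<lfloor>y i\<rfloor>)"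
  have "\<bar>real_of_int (u i)\<bar> \<le> \<bar>y i\<bar> + 1" for i
    unfolding u_def by (cases "h i \<ge> 0") (auto, linarith+)
  moreover have "h i * y i \<le> h i * u i" for i
    unfolding u_def by (auto intro: mult_left_mono mult_left_mono_neg)
  ultimately show ?thesis by (meson sum_mono)
qed

text \<open>
  Rounding costs nothing in value: a linear form does not decrease when each coordinate is rounded
  up or down according to the sign of its coefficient, and a bilinear form is linear in each
  argument separately.  The two arguments have to be rounded independently, so a quadratic form
  becomes a bilinear one.
\<close>
lemma bilinear_form_rounding:
  fixes M :: "nat \<Rightarrow> nat \<Rightarrow> real" and y :: "nat \<Rightarrow> real"
  obtains u v :: "nat \<Rightarrow> int"
  where "\<And>i. \<bar>real_of_int (u i)\<bar> \<le> \<bar>y i\<bar> + 1" "\<And>i. \<bar>real_of_int (v i)\<bar> \<le> \<bar>y i\<bar> + 1"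
    "(\<Sum>i<n. \<Sum>j<n. M i j * y i * y j) \<le> (\<Sum>i<n. \<Sum>j<n. M i j * u i * v j)"
proof -
  obtain u :: "nat \<Rightarrow> int" where u: "\<And>i. \<bar>real_of_int (u i)\<bar> \<le> \<bar>y i\<bar> + 1"
    "(\<Sum>i<n. (\<Sum>j<n. M i j * y j) * y i) \<le> (\<Sum>i<n. (\<Sum>j<n. M i j * y j) * u i)"
    using linear_form_rounding[of y "\<lambda>i. \<Sum>j<n. M i j * y j" n] by blast
  obtain v :: "nat \<Rightarrow> int" where v: "\<And>i. \<bar>real_of_int (v i)\<bar> \<le> \<bar>y i\<bar> + 1"
    "(\<Sum>j<n. (\<Sum>i<n. M i j * u i) * y j) \<le> (\<Sum>j<n. (\<Sum>i<n. M i j * u i) * v j)"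
    using linear_form_rounding[of y "\<lambda>j. \<Sum>i<n. M i j * u i" n] by blast
  have "(\<Sum>i<n. \<Sum>j<n. M i j * y i * y j) = (\<Sum>i<n. (\<Sum>j<n. M i j * y j) * y i)"
    by (simp add: sum_distrib_left sum_distrib_right mult_ac)
  also note u(2)
  also have "(\<Sum>i<n. (\<Sum>j<n. M i j * y j) * u i) = (\<Sum>j<n. (\<Sum>i<n. M i j * u i) * y j)"
    unfolding sum_distrib_left sum_distrib_right by (subst sum.swap) (simp add: mult_ac)
  also note v(2)
  also have "(\<Sum>j<n. (\<Sum>i<n. M i j * u i) * v j) = (\<Sum>i<n. \<Sum>j<n. M i j * u i * v j)"
    unfolding sum_distrib_left sum_distrib_right by (subst sum.swap) (simp add: mult_ac)
  finally show ?thesis using that u(1) v(1) by blast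
qed

text \<open>
  The threshold \<open>R\<close> separates the light coordinates, which \<open>discrete\<close> controls after rounding, from
  the heavy ones.  The second threshold \<open>\<eta> R\<close> guarantees that a pair with a heavy coordinate either
  lies in the sparse set \<open>U\<close> or has ratio at most \<open>\<eta>\<close>.  Outside the light pairs \<open>A\<close> and its mean \<open>p\<close> are
  estimated separately, without cancellation; the mean contributes little since
  \<open>\<bar>x i\<bar> \<le> (x i)\<^sup>2 / R\<close> for heavy \<open>i\<close>.  The five summands of the bound stand for the light pairs, the
  sparse set (two), the unequal pairs and the mean.
\<close>
lemma fluctuation_form_bound:
  fixes a p :: "nat \<Rightarrow> nat \<Rightarrow> real" and x :: "nat \<Rightarrow> real" and P R \<Delta> \<eta> \<tau> k l :: real
  assumes sym: "\<And>i j. a i j = a j i" and nonneg: "\<And>i j. 0 \<le> a i j" and diag: "\<And>i. a i i = 0"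
    and p: "\<And>i j. 0 \<le> p i j" "\<And>i j. p i j \<le> P"
    and degree: "\<And>i. i < n \<Longrightarrow> (\<Sum>j<n. a i j) \<le> \<Delta>"
    and sparse: "\<And>S. S \<subseteq> {..<n} \<Longrightarrow> S \<noteq> {} \<Longrightarrow> card S * (\<eta> * R)\<^sup>2 \<le> n \<Longrightarrow> (\<Sum>i\<in>S. \<Sum>j\<in>S. a i j) \<le> k * card S"
    and discrete: "\<And>u v :: nat \<Rightarrow> int. (\<Sum>i<n. (u i)\<^sup>2) \<le> 4 * int n \<Longrightarrow> (\<Sum>i<n. (v i)\<^sup>2) \<le> 4 * int n \<Longrightarrow>
      (\<And>i. i < n \<Longrightarrow> \<bar>real_of_int (u i)\<bar> \<le> R + 1) \<Longrightarrow> (\<And>i. i < n \<Longrightarrow> \<bar>real_of_int (v i)\<bar> \<le> R + 1) \<Longrightarrow>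
      (\<Sum>i<n. \<Sum>j<n. (a i j - p i j) * u i * v j) \<le> \<tau> * n"
    and x: "(\<Sum>i<n. (x i)\<^sup>2) \<le> n"
    and R: "R > 0" and \<eta>: "0 < \<eta>" "\<eta> \<le> 1" and l: "l > 0" and k: "k \<ge> 0" and \<Delta>: "\<Delta> \<ge> 0"
  shows "(\<Sum>i<n. \<Sum>j<n. (a i j - p i j) * x i * x j) \<le> (\<tau> + l * k + \<Delta> / l + 2 * \<eta> * \<Delta> + 2 * P * n / R) * n"
proof -
  define y where "y = (\<lambda>i. if \<bar>x i\<bar> > R then 0 else x i)"
  define U where "U = {i. i < n \<and> \<bar>x i\<bar> > \<eta> * R}"
  define z where "z = (\<lambda>i. if i \<in> U then \<bar>x i\<bar> else 0)"
  have P: "P \<ge> 0" using p(1)[of 0 0] p(2)[of 0 0] by linarith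
  have y_le: "\<bar>y i\<bar> \<le> \<bar>x i\<bar>" "\<bar>y i\<bar> \<le> R" for i using R by (auto simp: y_def)
  have small: "\<bar>x i\<bar> * \<bar>x j\<bar> \<le> z i * z j + \<eta> * ((x i)\<^sup>2 + (x j)\<^sup>2)"
    if big: "\<bar>x i\<bar> > R" and ij: "i < n" "j < n" for i j
  proof (cases "j \<in> U")
    case True
    have "\<eta> * R \<le> R" using \<eta> R by simp
    then have "i \<in> U" using big ij by (simp add: U_def)
    then show ?thesis using True \<eta> by (simp add: z_def)
  next
    case False
    then have "\<bar>x j\<bar> \<le> \<eta> * R" using ij by (simp add: U_def)
    also have "\<dots> \<le> \<eta> * \<bar>x i\<bar>" using big \<eta> by simp
    finally have "\<bar>x i\<bar> * \<bar>x j\<bar> \<le> \<bar>x i\<bar> * (\<eta> * \<bar>x i\<bar>)" by (intro mult_left_mono) auto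
    also have "\<dots> = \<eta> * (x i)\<^sup>2" by (simp add: power2_eq_square)
    also have "\<dots> \<le> \<eta> * ((x i)\<^sup>2 + (x j)\<^sup>2)" using \<eta> by (intro mult_left_mono) auto
    finally show ?thesis using False by (simp add: z_def)
  qed
  have pointwise: "(a i j - p i j) * x i * x j \<le> (a i j - p i j) * y i * y j
      + (a i j * z i * z j + (\<eta> * (a i j * (x i)\<^sup>2) + \<eta> * (a i j * (x j)\<^sup>2)) 
      + P / R * ((x i)\<^sup>2 * \<bar>x j\<bar> + (x j)\<^sup>2 * \<bar>x i\<bar>))" (is "?L \<le> ?M + ?E")
    if ij: "i < n" "j < n" for i j
  proof (cases "\<bar>x i\<bar> > R \<or> \<bar>x j\<bar> > R")
    case False
    have "0 \<le> ?E"
      using nonneg[of i j] \<eta> P R by (simp add: z_def)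
    then show ?thesis using False by (simp add: y_def)
  next
    case True
    have "\<bar>x i\<bar> * \<bar>x j\<bar> \<le> z i * z j + \<eta> * ((x i)\<^sup>2 + (x j)\<^sup>2)"
      using True small[of i j] small[of j i] ij by (auto simp: mult_ac add_ac)
    then have "a i j * (\<bar>x i\<bar> * \<bar>x j\<bar>) \<le> a i j * (z i * z j + \<eta> * ((x i)\<^sup>2 + (x j)\<^sup>2))"
      by (intro mult_left_mono nonneg)
    moreover have "p i j * (\<bar>x i\<bar> * \<bar>x j\<bar>) \<le> P / R * ((x i)\<^sup>2 * \<bar>x j\<bar> + (x j)\<^sup>2 * \<bar>x i\<bar>)"
    proof -
      have *: "R * (\<bar>s\<bar> * \<bar>t\<bar>) \<le> s\<^sup>2 * \<bar>t\<bar> + t\<^sup>2 * \<bar>s\<bar>" if "\<bar>s\<bar> > R" for s t :: real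
      proof -
        have "R * (\<bar>s\<bar> * \<bar>t\<bar>) \<le> \<bar>s\<bar> * (\<bar>s\<bar> * \<bar>t\<bar>)"
          using that by (intro mult_right_mono) auto
        also have "\<dots> = s\<^sup>2 * \<bar>t\<bar>" by (simp add: power2_eq_square)
        finally show ?thesis by (simp add: add_increasing2)
      qed
      have "R * (\<bar>x i\<bar> * \<bar>x j\<bar>) \<le> (x i)\<^sup>2 * \<bar>x j\<bar> + (x j)\<^sup>2 * \<bar>x i\<bar>"
        using True *[of "x i" "x j"] *[of "x j" "x i"] by (auto simp: mult_ac add_ac)
      then have "P / R * (R * (\<bar>x i\<bar> * \<bar>x j\<bar>)) \<le> P / R * ((x i)\<^sup>2 * \<bar>x j\<bar> + (x j)\<^sup>2 * \<bar>x i\<bar>)"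
        using P R by (intro mult_left_mono) auto
      moreover have "p i j * (\<bar>x i\<bar> * \<bar>x j\<bar>) \<le> P * (\<bar>x i\<bar> * \<bar>x j\<bar>)"
        by (intro mult_right_mono p) auto
      ultimately show ?thesis using R by simp
    qed
    moreover have "(a i j - p i j) * x i * x j \<le> a i j * (\<bar>x i\<bar> * \<bar>x j\<bar>) + p i j * (\<bar>x i\<bar> * \<bar>x j\<bar>)"
    proof -
      have "(a i j - p i j) * x i * x j \<le> \<bar>a i j - p i j\<bar> * (\<bar>x i\<bar> * \<bar>x j\<bar>)"
        by (metis abs_ge_self abs_mult mult.assoc)
      also have "\<dots> \<le> (a i j + p i j) * (\<bar>x i\<bar> * \<bar>x j\<bar>)"
        using nonneg[of i j] p(1)[of i j] by (intro mult_right_mono) auto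
      finally show ?thesis by (simp add: algebra_simps)
    qed
    ultimately have "(a i j - p i j) * x i * x j \<le> ?E" by (simp add: algebra_simps)
    moreover have "?M = 0" using True by (auto simp: y_def)
    ultimately show ?thesis by linarith
  qed
  have light: "(\<Sum>i<n. \<Sum>j<n. (a i j - p i j) * y i * y j) \<le> \<tau> * n"
  proof -
    obtain u v :: "nat \<Rightarrow> int" where uv: "\<And>i. \<bar>real_of_int (u i)\<bar> \<le> \<bar>y i\<bar> + 1" "\<And>i. \<bar>real_of_int (v i)\<bar> \<le> \<bar>y i\<bar> + 1"
      "(\<Sum>i<n. \<Sum>j<n. (a i j - p i j) * y i * y j) \<le> (\<Sum>i<n. \<Sum>j<n. (a i j - p i j) * u i * v j)"
      using bilinear_form_rounding[of y "\<lambda>i j. a i j - p i j" n] by blast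
    have norm: "(\<Sum>i<n. (w i)\<^sup>2) \<le> 4 * int n" if w: "\<And>i. \<bar>real_of_int (w i)\<bar> \<le> \<bar>y i\<bar> + 1" for w
    proof -
      have "(real_of_int (w i))\<^sup>2 \<le> 2 * (x i)\<^sup>2 + 2" for i
      proof -
        have "(real_of_int (w i))\<^sup>2 \<le> (\<bar>x i\<bar> + 1)\<^sup>2"
          using w[of i] y_le[of i] by (intro abs_le_square_iff[THEN iffD1]) auto
        also have "\<dots> \<le> 2 * (x i)\<^sup>2 + 2"
          using sum_squares_bound[of "\<bar>x i\<bar>" 1] by (simp add: power2_eq_square algebra_simps)
        finally show ?thesis .
      qed
      then have "(\<Sum>i<n. (real_of_int (w i))\<^sup>2) \<le> (\<Sum>i<n. 2 * (x i)\<^sup>2 + 2)" by (intro sum_mono)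
      also have "\<dots> = 2 * (\<Sum>i<n. (x i)\<^sup>2) + 2 * n" by (simp add: sum.distrib sum_distrib_left)
      also have "\<dots> \<le> 4 * n" using x by simp
      finally have "real_of_int (\<Sum>i<n. (w i)\<^sup>2) \<le> real_of_int (4 * int n)" by simp
      then show ?thesis by (simp only: of_int_le_iff)
    qed
    have "\<bar>real_of_int (u i)\<bar> \<le> R + 1" "\<bar>real_of_int (v i)\<bar> \<le> R + 1" for i
      using uv(1,2)[of i] y_le(2)[of i] by auto
    then have "(\<Sum>i<n. \<Sum>j<n. (a i j - p i j) * u i * v j) \<le> \<tau> * n"
      by (intro discrete norm uv)
    then show ?thesis using uv(3) by linarith
  qed
  have U: "finite U" "U \<subseteq> {..<n}" by (auto simp: U_def)
  have heavy: "(\<Sum>i<n. \<Sum>j<n. a i j * z i * z j) \<le> (l * k + \<Delta> / l) * n"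
  proof -
    have card_le: "card S * (\<eta> * R)\<^sup>2 \<le> n" if "S \<subseteq> U" for S
    proof -
      have "(\<eta> * R)\<^sup>2 \<le> (x i)\<^sup>2" if "i \<in> U" for i
        using that \<eta> R by (intro abs_le_square_iff[THEN iffD1]) (auto simp: U_def)
      then have "(\<Sum>i\<in>S. (\<eta> * R)\<^sup>2) \<le> (\<Sum>i\<in>S. (x i)\<^sup>2)" using that by (intro sum_mono) auto
      also have "\<dots> \<le> (\<Sum>i<n. (x i)\<^sup>2)" using that U by (intro sum_mono2) auto
      finally show ?thesis using x by simp
    qed
    have "(\<Sum>i<n. \<Sum>j<n. a i j * z i * z j) = (\<Sum>i\<in>U. \<Sum>j<n. a i j * z i * z j)"
      using U by (intro sum.mono_neutral_right) (auto simp: z_def)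
    also have "\<dots> = (\<Sum>i\<in>U. \<Sum>j\<in>U. a i j * z i * z j)"
      using U by (intro sum.cong refl sum.mono_neutral_right) (auto simp: z_def)
    also have "\<dots> \<le> (\<Sum>i\<in>U. (l * k + (\<Sum>j\<in>U. a i j) / l) * (z i)\<^sup>2)"
      by (intro degenerate_form_bound U sym nonneg diag l sparse card_le) (use U in auto)
    also have "\<dots> \<le> (\<Sum>i\<in>U. (l * k + \<Delta> / l) * (z i)\<^sup>2)"
    proof (intro sum_mono mult_right_mono add_left_mono divide_right_mono)
      fix i assume "i \<in> U"
      have "(\<Sum>j\<in>U. a i j) \<le> (\<Sum>j<n. a i j)" using U by (intro sum_mono2 nonneg) auto
      also have "\<dots> \<le> \<Delta>" using \<open>i \<in> U\<close> U by (intro degree) auto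
      finally show "(\<Sum>j\<in>U. a i j) \<le> \<Delta>" .
    qed (use l in auto)
    also have "\<dots> = (l * k + \<Delta> / l) * (\<Sum>i\<in>U. (x i)\<^sup>2)"
      unfolding sum_distrib_left by (intro sum.cong) (auto simp: z_def)
    also have "\<dots> \<le> (l * k + \<Delta> / l) * n"
    proof (rule mult_left_mono)
      have "(\<Sum>i\<in>U. (x i)\<^sup>2) \<le> (\<Sum>i<n. (x i)\<^sup>2)" using U by (intro sum_mono2) auto
      then show "(\<Sum>i\<in>U. (x i)\<^sup>2) \<le> n" using x by linarith
    qed (use l k \<Delta> in simp)
    finally show ?thesis .
  qed
  have deg_form: "(\<Sum>i<n. \<Sum>j<n. a i j * (x i)\<^sup>2) \<le> \<Delta> * n"
  proof -
    have "(\<Sum>i<n. \<Sum>j<n. a i j * (x i)\<^sup>2) = (\<Sum>i<n. (\<Sum>j<n. a i j) * (x i)\<^sup>2)"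
      by (simp add: sum_distrib_right)
    also have "\<dots> \<le> (\<Sum>i<n. \<Delta> * (x i)\<^sup>2)" by (intro sum_mono mult_right_mono degree) auto
    also have "\<dots> = \<Delta> * (\<Sum>i<n. (x i)\<^sup>2)" by (simp add: sum_distrib_left)
    also have "\<dots> \<le> \<Delta> * n" by (intro mult_left_mono x \<Delta>)
    finally show ?thesis .
  qed
  have deg_form': "(\<Sum>i<n. \<Sum>j<n. a i j * (x j)\<^sup>2) \<le> \<Delta> * n"
    using deg_form by (subst sum.swap) (simp add: sym[of _ i for i])
  have l1: "(\<Sum>i<n. \<Sum>j<n. (x i)\<^sup>2 * \<bar>x j\<bar>) \<le> real n * n"
  proof -
    have "(\<Sum>j<n. \<bar>x j\<bar>) \<le> (\<Sum>j<n. (1 + (x j)\<^sup>2) / 2)"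
    proof (rule sum_mono)
      show "\<bar>x j\<bar> \<le> (1 + (x j)\<^sup>2) / 2" for j
        using sum_squares_bound[of "\<bar>x j\<bar>" 1] by simp
    qed
    also have "\<dots> = (n + (\<Sum>j<n. (x j)\<^sup>2)) / 2" by (simp add: sum.distrib flip: sum_divide_distrib)
    also have "\<dots> \<le> n" using x by simp
    finally have "(\<Sum>i<n. (x i)\<^sup>2) * (\<Sum>j<n. \<bar>x j\<bar>) \<le> real n * n"
      using x by (intro mult_mono) (auto intro: sum_nonneg)
    then show ?thesis by (simp add: sum_product)
  qed
  have l1': "(\<Sum>i<n. \<Sum>j<n. (x j)\<^sup>2 * \<bar>x i\<bar>) \<le> real n * n"
    using l1 by (subst sum.swap)
  have "(\<Sum>i<n. \<Sum>j<n. (a i j - p i j) * x i * x j) \<le>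
      (\<Sum>i<n. \<Sum>j<n. (a i j - p i j) * y i * y j
      + (a i j * z i * z j + (\<eta> * (a i j * (x i)\<^sup>2) + \<eta> * (a i j * (x j)\<^sup>2)) 
      + P / R * ((x i)\<^sup>2 * \<bar>x j\<bar> + (x j)\<^sup>2 * \<bar>x i\<bar>)))"
    by (intro sum_mono pointwise) auto
  also have "\<dots> = (\<Sum>i<n. \<Sum>j<n. (a i j - p i j) * y i * y j) + ((\<Sum>i<n. \<Sum>j<n. a i j * z i * z j)
      + (\<eta> * (\<Sum>i<n. \<Sum>j<n. a i j * (x i)\<^sup>2) + \<eta> * (\<Sum>i<n. \<Sum>j<n. a i j * (x j)\<^sup>2))
      + P / R * ((\<Sum>i<n. \<Sum>j<n. (x i)\<^sup>2 * \<bar>x j\<bar>) + (\<Sum>i<n. \<Sum>j<n. (x j)\<^sup>2 * \<bar>x i\<bar>)))"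
    by (simp only: sum.distrib flip: sum_distrib_left)
  also have "\<dots> \<le> \<tau> * n + ((l * k + \<Delta> / l) * n + (\<eta> * (\<Delta> * n) + \<eta> * (\<Delta> * n)) + P / R * (real n * n + real n * n))"
    using \<eta> P R by (intro add_mono mult_left_mono light heavy deg_form deg_form' l1 l1') auto
  also have "\<dots> = (\<tau> + l * k + \<Delta> / l + 2 * \<eta> * \<Delta> + 2 * P * n / R) * n"
    by (simp add: algebra_simps)
  finally show ?thesis .
qed

section \<open>Exponential tail bounds for the block model\<close>

definition adj :: "nat set set \<Rightarrow> nat \<Rightarrow> nat \<Rightarrow> real" where
  "adj E i j = (if i \<noteq> j \<and> {i, j} \<in> E then 1 else 0)"

lemma sum_square_eq_triangle:
  fixes h :: "nat \<Rightarrow> nat \<Rightarrow> real"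
  shows "(\<Sum>i<n. \<Sum>j<n. h i j) = (\<Sum>i<n. h i i) + (\<Sum>i<n. \<Sum>j<i. h i j + h j i)"
  by (induction n) (simp_all add: sum.distrib)

lemma sum_triangle_le_square:
  fixes h :: "nat \<Rightarrow> nat \<Rightarrow> real"
  assumes "\<And>i. i < n \<Longrightarrow> 0 \<le> h i i"
  shows "(\<Sum>i<n. \<Sum>j<i. h i j + h j i) \<le> (\<Sum>i<n. \<Sum>j<n. h i j)"
  unfolding sum_square_eq_triangle using assms by (auto intro!: sum_nonneg)

lemma vertex_pairs_Suc:
  "vertex_pairs (Suc n) = vertex_pairs n \<union> (\<lambda>j. {n, j}) ` {..<n}"
  "vertex_pairs n \<inter> (\<lambda>j. {n, j}) ` {..<n} = {}"
proof -
  show "vertex_pairs (Suc n) = vertex_pairs n \<union> (\<lambda>j. {n, j}) ` {..<n}"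
  proof
    show "vertex_pairs (Suc n) \<subseteq> vertex_pairs n \<union> (\<lambda>j. {n, j}) ` {..<n}"
    proof
      fix e assume "e \<in> vertex_pairs (Suc n)"
      then obtain i j where e: "e = {i, j}" "i < Suc n" "j < Suc n" "i \<noteq> j"
        by (auto simp: vertex_pairs_def)
      then consider "i < n" "j < n" | "i = n" "j < n" | "j = n" "i < n" by linarith
      then show "e \<in> vertex_pairs n \<union> (\<lambda>j. {n, j}) ` {..<n}"
        using e by cases (auto simp: vertex_pairs_def insert_commute)
    qed
    show "vertex_pairs n \<union> (\<lambda>j. {n, j}) ` {..<n} \<subseteq> vertex_pairs (Suc n)"
      by (fastforce simp: vertex_pairs_def)
  qed
  show "vertex_pairs n \<inter> (\<lambda>j. {n, j}) ` {..<n} = {}"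
    by (auto simp: vertex_pairs_def doubleton_eq_iff)
qed

lemma finite_vertex_pairs: "finite (vertex_pairs n)"
proof (induction n)
  case 0
  then show ?case by (simp add: vertex_pairs_def)
next
  case (Suc n)
  then show ?case by (simp add: vertex_pairs_Suc(1))
qed

lemma sum_vertex_pairs:
  fixes f :: "nat set \<Rightarrow> real"
  shows "(\<Sum>e\<in>vertex_pairs n. f e) = (\<Sum>i<n. \<Sum>j<i. f {i, j})"
proof (induction n)
  case 0
  then show ?case by (simp add: vertex_pairs_def)
next
  case (Suc n)
  have "inj_on (\<lambda>j. {n, j}) {..<n}" by (auto simp: inj_on_def doubleton_eq_iff)
  then show ?case
    using Suc by (simp add: vertex_pairs_Suc(1) sum.union_disjoint finite_vertex_pairs vertex_pairs_Suc(2) sum.reindex)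
qed

lemma edge_prob_pair: "edge_prob p q g {i, j} = (if vec_index g i = vec_index g j then p else q)"
  by (auto simp: edge_prob_def)

text \<open>
  One inequality serves all tail estimates below.  The exponential scale is absorbed in the
  coefficients, and an edge has the coefficient \<open>c i j + c j i\<close> because the double sum meets it twice.
\<close>
lemma sbm_chernoff:
  fixes c :: "nat \<Rightarrow> nat \<Rightarrow> real"
  assumes "0 \<le> p" "p \<le> 1" "0 \<le> q" "q \<le> 1"
  shows "measure_pmf.prob (sbm n p q g) {E. t \<le> (\<Sum>i<n. \<Sum>j<n. c i j * adj E i j)}
    \<le> exp (- t + (\<Sum>i<n. \<Sum>j<i. edge_prob p q g {i, j} * (exp (c i j + c j i) - 1)))"
proof -
  \<comment> \<open>a function of the unordered pair, as the product measure is indexed by edges\<close>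
  define b where "b = (\<lambda>e. c (Max e) (Min e) + c (Min e) (Max e))"
  have b: "b {i, j} = c i j + c j i" if "j < i" for i j :: nat
    using that by (simp add: b_def max_def min_def)
  define Q where "Q = Pi_pmf (vertex_pairs n) False (\<lambda>e. bernoulli_pmf (edge_prob p q g e))"
  define u where "u = (\<lambda>f. \<Prod>e\<in>vertex_pairs n. exp (b e * of_bool (f e)))"
  have ep: "0 \<le> edge_prob p q g e" "edge_prob p q g e \<le> 1" for e
    using assms by (auto simp: edge_prob_def)
  have lin: "(\<Sum>i<n. \<Sum>j<n. c i j * adj (Collect f) i j) = (\<Sum>e\<in>vertex_pairs n. b e * of_bool (f e))" for f
    unfolding sum_square_eq_triangle sum_vertex_pairs
    by (auto simp: adj_def b insert_commute algebra_simps intro!: sum.cong)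
  have u_eq: "u f = exp (\<Sum>i<n. \<Sum>j<n. c i j * adj (Collect f) i j)" for f
    unfolding lin u_def by (simp only: exp_sum[OF finite_vertex_pairs])
  have int: "integrable (measure_pmf Q) u"
    unfolding Q_def u_def
    by (intro integrable_prod_Pi_pmf finite_vertex_pairs integrable_measure_pmf_finite) auto
  have "measure_pmf.prob (sbm n p q g) {E. t \<le> (\<Sum>i<n. \<Sum>j<n. c i j * adj E i j)} =
      measure_pmf.prob Q {f. exp t \<le> u f}"
    unfolding sbm_def Q_def[symmetric] measure_map_pmf u_eq by (simp add: vimage_def)
  also have "\<dots> \<le> measure_pmf.expectation Q u / exp t"
  proof -
    have "0 \<le> u f" for f by (simp add: u_eq)
    then show ?thesis
      using integral_Markov_inequality_measure[OF int, of UNIV "exp t"] by simp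
  qed
  also have "measure_pmf.expectation Q u =
      (\<Prod>e\<in>vertex_pairs n. measure_pmf.expectation (bernoulli_pmf (edge_prob p q g e)) (\<lambda>v. exp (b e * of_bool v)))"
    unfolding Q_def u_def
    by (intro expectation_prod_Pi_pmf finite_vertex_pairs integrable_measure_pmf_finite) auto
  also have "\<dots> = (\<Prod>e\<in>vertex_pairs n. 1 + edge_prob p q g e * (exp (b e) - 1))"
    using ep by (intro prod.cong refl) (simp add: algebra_simps)
  also have "\<dots> \<le> (\<Prod>e\<in>vertex_pairs n. exp (edge_prob p q g e * (exp (b e) - 1)))"
  proof (intro prod_mono conjI)
    fix e
    have "0 \<le> (1 - edge_prob p q g e) + edge_prob p q g e * exp (b e)"
      using ep[of e] by (intro add_nonneg_nonneg mult_nonneg_nonneg) auto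
    then show "0 \<le> 1 + edge_prob p q g e * (exp (b e) - 1)" by (simp add: algebra_simps)
  qed (rule exp_ge_add_one_self)
  also have "\<dots> = exp (\<Sum>i<n. \<Sum>j<i. edge_prob p q g {i, j} * (exp (c i j + c j i) - 1))"
    by (simp add: exp_sum[symmetric] finite_vertex_pairs sum_vertex_pairs b)
  finally show ?thesis
    by (subst exp_add) (simp add: exp_minus divide_inverse mult.commute)
qed

lemma degree_tail:
  assumes pq: "0 \<le> p" "p \<le> P" "0 \<le> q" "q \<le> P" "P \<le> 1" and "k < n"
  shows "measure_pmf.prob (sbm n p q g) {E. t \<le> (\<Sum>j<n. adj E k j)} \<le> exp (- t + 2 * P * n)"
proof -
  define c where "c = (\<lambda>i j::nat. if i = k then 1 else (0::real))"
  have "(\<Sum>i<n. \<Sum>j<n. c i j * adj E i j) = (\<Sum>j<n. adj E k j)" for E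
  proof -
    have "(\<Sum>i<n. \<Sum>j<n. c i j * adj E i j) = (\<Sum>i<n. if i = k then (\<Sum>j<n. adj E i j) else 0)"
      by (intro sum.cong refl) (simp add: c_def)
    then show ?thesis using \<open>k < n\<close> by simp
  qed
  then have "measure_pmf.prob (sbm n p q g) {E. t \<le> (\<Sum>j<n. adj E k j)} \<le>
     exp (- t + (\<Sum>i<n. \<Sum>j<i. edge_prob p q g {i, j} * (exp (c i j + c j i) - 1)))"
    using sbm_chernoff[of p q n g t c] pq by simp
  also have "(\<Sum>i<n. \<Sum>j<i. edge_prob p q g {i, j} * (exp (c i j + c j i) - 1)) \<le>
      (\<Sum>i<n. \<Sum>j<i. 2 * P * c i j + 2 * P * c j i)"
  proof (intro sum_mono)
    fix i j assume "i \<in> {..<n}" "j \<in> {..<i}"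
    then have "exp (c i j + c j i) - 1 \<le> 2 * (c i j + c j i)" "0 \<le> exp (c i j + c j i) - 1"
      using exp_le by (auto simp: c_def)
    then have "edge_prob p q g {i, j} * (exp (c i j + c j i) - 1) \<le> P * (2 * (c i j + c j i))"
      using pq by (intro mult_mono) (auto simp: edge_prob_pair)
    then show "edge_prob p q g {i, j} * (exp (c i j + c j i) - 1) \<le> 2 * P * c i j + 2 * P * c j i"
      by (simp add: algebra_simps)
  qed
  also have "\<dots> \<le> (\<Sum>i<n. \<Sum>j<n. 2 * P * c i j)"
    using pq by (intro sum_triangle_le_square) (auto simp: c_def)
  also have "\<dots> = 2 * P * n"
  proof -
    have "(\<Sum>i<n. \<Sum>j<n. 2 * P * c i j) = (\<Sum>i<n. if i = k then 2 * P * n else 0)"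
      by (intro sum.cong refl) (simp add: c_def)
    then show ?thesis using \<open>k < n\<close> by simp
  qed
  finally show ?thesis by simp
qed

lemma edges_within_tail:
  assumes pq: "0 \<le> p" "p \<le> P" "0 \<le> q" "q \<le> P" "P \<le> 1" and S: "S \<subseteq> {..<n}" and \<theta>: "\<theta> \<ge> 0"
  shows "measure_pmf.prob (sbm n p q g) {E. t \<le> (\<Sum>i\<in>S. \<Sum>j\<in>S. adj E i j)}
    \<le> exp (- \<theta> * t / 2 + P * exp \<theta> * (card S)\<^sup>2 / 2)"
proof (cases "\<theta> = 0")
  case True
  then show ?thesis
    using pq by (intro order_trans[OF measure_pmf.prob_le_1]) (simp add: mult_nonneg_nonneg)
next
  case False
  define s where "s = (\<lambda>i. if i \<in> S then 1 else (0::real))"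
  have sum_s: "(\<Sum>i<n. \<Sum>j<n. s i * s j * h i j) = (\<Sum>i\<in>S. \<Sum>j\<in>S. h i j)" for h :: "nat \<Rightarrow> nat \<Rightarrow> real"
  proof -
    have "(\<Sum>i<n. \<Sum>j<n. s i * s j * h i j) = (\<Sum>i\<in>S. \<Sum>j<n. s i * s j * h i j)"
      using S by (intro sum.mono_neutral_right) (auto simp: s_def)
    also have "\<dots> = (\<Sum>i\<in>S. \<Sum>j\<in>S. s i * s j * h i j)"
      using S by (intro sum.cong refl sum.mono_neutral_right) (auto simp: s_def)
    finally show ?thesis by (simp add: s_def)
  qed
  define c where "c = (\<lambda>i j. \<theta> / 2 * (s i * s j))"
  have "(\<Sum>i<n. \<Sum>j<n. c i j * adj E i j) = \<theta> / 2 * (\<Sum>i\<in>S. \<Sum>j\<in>S. adj E i j)" for E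
    unfolding sum_s[symmetric] by (simp add: c_def sum_distrib_left mult_ac)
  then have "measure_pmf.prob (sbm n p q g) {E. \<theta> / 2 * t \<le> \<theta> / 2 * (\<Sum>i\<in>S. \<Sum>j\<in>S. adj E i j)} \<le>
     exp (- (\<theta> / 2 * t) + (\<Sum>i<n. \<Sum>j<i. edge_prob p q g {i, j} * (exp (c i j + c j i) - 1)))"
    using sbm_chernoff[of p q n g "\<theta> / 2 * t" c] pq by simp
  also have "{E. \<theta> / 2 * t \<le> \<theta> / 2 * (\<Sum>i\<in>S. \<Sum>j\<in>S. adj E i j)} = {E. t \<le> (\<Sum>i\<in>S. \<Sum>j\<in>S. adj E i j)}"
    using \<theta> False by auto
  also have "(\<Sum>i<n. \<Sum>j<i. edge_prob p q g {i, j} * (exp (c i j + c j i) - 1)) \<le>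
      (\<Sum>i<n. \<Sum>j<i. P * exp \<theta> / 2 * (s i * s j) + P * exp \<theta> / 2 * (s j * s i))"
  proof (intro sum_mono)
    fix i j
    have "exp (c i j + c j i) - 1 \<le> exp \<theta> * (s i * s j)" "0 \<le> exp (c i j + c j i) - 1"
      using \<theta> by (auto simp: c_def s_def)
    then have "edge_prob p q g {i, j} * (exp (c i j + c j i) - 1) \<le> P * (exp \<theta> * (s i * s j))"
      using pq by (intro mult_mono) (auto simp: edge_prob_pair)
    then show "edge_prob p q g {i, j} * (exp (c i j + c j i) - 1) \<le>
        P * exp \<theta> / 2 * (s i * s j) + P * exp \<theta> / 2 * (s j * s i)"
      by (simp add: algebra_simps)
  qed
  also have "\<dots> \<le> (\<Sum>i<n. \<Sum>j<n. P * exp \<theta> / 2 * (s i * s j))"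
    using pq by (intro sum_triangle_le_square) (auto simp: s_def)
  also have "\<dots> = P * exp \<theta> * (card S)\<^sup>2 / 2"
    using sum_s[of "\<lambda>i j. P * exp \<theta> / 2"] by (simp add: mult_ac power2_eq_square)
  finally show ?thesis by simp
qed

text \<open>
  The node \<open>k\<close> has one potential neighbour less in its own cluster than in the other one.  Counting
  \<open>n / 2\<close> of them for both costs the factor \<open>exp (p * (1 - exp (- \<theta>))) \<le> exp 1\<close>.
\<close>
lemma margin_tail:
  assumes pq: "0 \<le> p" "p \<le> 1" "0 \<le> q" "q \<le> 1" and g: "balanced_partition n g" and "k < n" and \<theta>: "\<theta> > 0"
  shows "measure_pmf.prob (sbm n p q g)
      {E. (\<Sum>j<n. adj E k j * vec_index g k * vec_index g j) \<le> t}
    \<le> exp (\<theta> * t + n / 2 * (p * (exp (- \<theta>) - 1) + q * (exp \<theta> - 1)) + 1)"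
proof -
  define \<gamma> where "\<gamma> = vec_index g"
  have signs: "\<gamma> i = 1 \<or> \<gamma> i = -1" if "i < n" for i
    using g that by (auto simp: balanced_partition_def \<gamma>_def)
  have bal: "(\<Sum>i<n. \<gamma> i) = 0"
    using balanced_partition_signs(2)[OF g] by (simp add: \<gamma>_def)
  define c where "c = (\<lambda>i j. if i = k then - \<theta> * (\<gamma> i * \<gamma> j) else 0)"
  define h where "h = (\<lambda>i j. if i = k then edge_prob p q g {i, j} * (exp (- \<theta> * (\<gamma> i * \<gamma> j)) - 1) else 0)"
  have row: "(\<Sum>i<n. \<Sum>j<n. if i = k then f i j else 0) = (\<Sum>j<n. f k j)" for f :: "nat \<Rightarrow> nat \<Rightarrow> real"
  proof -
    have "(\<Sum>i<n. \<Sum>j<n. if i = k then f i j else 0) = (\<Sum>i<n. if i = k then (\<Sum>j<n. f i j) else 0)"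
      by (intro sum.cong refl) simp
    then show ?thesis using \<open>k < n\<close> by simp
  qed
  have lin: "(\<Sum>i<n. \<Sum>j<n. c i j * adj E i j) = - \<theta> * (\<Sum>j<n. adj E k j * \<gamma> k * \<gamma> j)" for E
  proof -
    have "(\<Sum>i<n. \<Sum>j<n. c i j * adj E i j) =
        (\<Sum>i<n. \<Sum>j<n. if i = k then - \<theta> * (\<gamma> i * \<gamma> j) * adj E i j else 0)"
      by (intro sum.cong refl) (simp add: c_def)
    also have "\<dots> = - \<theta> * (\<Sum>j<n. adj E k j * \<gamma> k * \<gamma> j)"
      unfolding row sum_distrib_left by (simp add: mult_ac)
    finally show ?thesis .
  qed
  have "{E. (\<Sum>j<n. adj E k j * \<gamma> k * \<gamma> j) \<le> t} = {E. - \<theta> * t \<le> (\<Sum>i<n. \<Sum>j<n. c i j * adj E i j)}"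
    unfolding lin using \<theta> by auto
  then have "measure_pmf.prob (sbm n p q g) {E. (\<Sum>j<n. adj E k j * \<gamma> k * \<gamma> j) \<le> t} \<le>
     exp (\<theta> * t + (\<Sum>i<n. \<Sum>j<i. edge_prob p q g {i, j} * (exp (c i j + c j i) - 1)))"
    using sbm_chernoff[of p q n g "- \<theta> * t" c] pq by simp
  also have "(\<Sum>i<n. \<Sum>j<i. edge_prob p q g {i, j} * (exp (c i j + c j i) - 1)) = (\<Sum>i<n. \<Sum>j<i. h i j + h j i)"
    by (intro sum.cong refl) (auto simp: c_def h_def insert_commute mult_ac)
  also have "\<dots> = (\<Sum>j<n. h k j) - h k k"
    using sum_square_eq_triangle[of h n] \<open>k < n\<close>
      row[of "\<lambda>i j. edge_prob p q g {i, j} * (exp (- \<theta> * (\<gamma> i * \<gamma> j)) - 1)"]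
    by (simp add: h_def)
  also have "(\<Sum>j<n. h k j) = (\<Sum>j<n. (p * (exp (- \<theta>) - 1) + q * (exp \<theta> - 1)) / 2
      + \<gamma> k * (p * (exp (- \<theta>) - 1) - q * (exp \<theta> - 1)) / 2 * \<gamma> j)"
  proof (intro sum.cong refl)
    fix j assume "j \<in> {..<n}"
    then show "h k j = (p * (exp (- \<theta>) - 1) + q * (exp \<theta> - 1)) / 2
      + \<gamma> k * (p * (exp (- \<theta>) - 1) - q * (exp \<theta> - 1)) / 2 * \<gamma> j"
      using signs[of j] signs[OF \<open>k < n\<close>]
      by (auto simp: h_def edge_prob_pair simp flip: \<gamma>_def) (simp_all add: field_simps)
  qed
  also have "\<dots> = n / 2 * (p * (exp (- \<theta>) - 1) + q * (exp \<theta> - 1))"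
    by (simp add: sum.distrib bal flip: sum_distrib_left sum_divide_distrib)
  also have "exp (\<theta> * t + (n / 2 * (p * (exp (- \<theta>) - 1) + q * (exp \<theta> - 1)) - h k k)) \<le>
      exp (\<theta> * t + n / 2 * (p * (exp (- \<theta>) - 1) + q * (exp \<theta> - 1)) + 1)"
  proof -
    have "- h k k = p * (1 - exp (- \<theta>))"
      using signs[OF \<open>k < n\<close>] by (auto simp: h_def edge_prob_pair algebra_simps)
    also have "\<dots> \<le> 1 * 1" using pq \<theta> by (intro mult_mono) auto
    finally show ?thesis by simp
  qed
  finally show ?thesis by (simp only: \<gamma>_def)
qed

lemma exp_le_quadratic:
  fixes b :: real
  assumes "\<bar>b\<bar> \<le> 1"
  shows "exp b - 1 \<le> b + b\<^sup>2"
proof (cases "b \<ge> 0")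
  case True
  then show ?thesis using exp_bound[of b] assms by simp
next
  case False
  define y where "y = - b"
  have y: "0 < y" using False by (simp add: y_def)
  have "1 \<le> (1 + y) * (1 - y + y\<^sup>2)"
  proof -
    have "(1 + y) * (1 - y + y\<^sup>2) = 1 + y ^ 3" by (simp add: power2_eq_square power3_eq_cube algebra_simps)
    then show ?thesis using y by simp
  qed
  also have "\<dots> \<le> exp y * (1 - y + y\<^sup>2)"
  proof (rule mult_right_mono)
    show "0 \<le> 1 - y + y\<^sup>2" using assms y by (simp add: y_def)
  qed simp
  finally have "exp (- y) \<le> 1 - y + y\<^sup>2"
    by (simp add: exp_minus field_simps)
  then show ?thesis by (simp add: y_def)
qed

text \<open>
  The bound on the entries keeps all exponents in \<open>[-1, 1]\<close>, where the moment generating function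
  is at most quadratic; the linear terms cancel against the mean.  The constant is \<open>32 = 2 * 4 * 4\<close>,
  with the factor \<open>2\<close> from \<open>(x + y)\<^sup>2 \<le> 2 x\<^sup>2 + 2 y\<^sup>2\<close> and the others from the two squared norms.
\<close>
lemma bilinear_form_tail:
  fixes u v :: "nat \<Rightarrow> int" and B l p q P t :: real
  assumes pq: "0 \<le> p" "p \<le> P" "0 \<le> q" "q \<le> P" "P \<le> 1"
    and u: "(\<Sum>i<n. (u i)\<^sup>2) \<le> 4 * int n" "\<And>i. i < n \<Longrightarrow> \<bar>real_of_int (u i)\<bar> \<le> B"
    and v: "(\<Sum>i<n. (v i)\<^sup>2) \<le> 4 * int n" "\<And>i. i < n \<Longrightarrow> \<bar>real_of_int (v i)\<bar> \<le> B"
    and l: "l > 0" "2 * l * B\<^sup>2 \<le> 1"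
  shows "measure_pmf.prob (sbm n p q g)
      {E. t \<le> (\<Sum>i<n. \<Sum>j<n. (adj E i j - (if i = j then 0 else edge_prob p q g {i, j})) * u i * v j)}
    \<le> exp (- l * t + 32 * l\<^sup>2 * P * (real n)\<^sup>2)"
proof -
  define e where "e = (\<lambda>i j. edge_prob p q g {i, j})"
  have e: "0 \<le> e i j" "e i j \<le> P" "e i j = e j i" for i j
    using pq by (auto simp: e_def edge_prob_pair)
  define m where "m = (\<Sum>i<n. \<Sum>j<n. (if i = j then 0 else e i j) * u i * v j)"
  define c where "c = (\<lambda>i j. l * u i * v j)"
  have split: "(\<Sum>i<n. \<Sum>j<n. (adj E i j - (if i = j then 0 else e i j)) * u i * v j) =
      (\<Sum>i<n. \<Sum>j<n. adj E i j * u i * v j) - m" for E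
    unfolding m_def sum_subtractf[symmetric] by (simp add: left_diff_distrib)
  have lin: "(\<Sum>i<n. \<Sum>j<n. c i j * adj E i j) = l * (\<Sum>i<n. \<Sum>j<n. adj E i j * u i * v j)" for E
    by (simp add: c_def sum_distrib_left mult_ac)
  have mean: "l * m = (\<Sum>i<n. \<Sum>j<i. e i j * (c i j + c j i))"
    unfolding m_def sum_square_eq_triangle
    by (auto simp: sum_distrib_left c_def e(3) algebra_simps intro!: sum.cong)
  have "{E. t \<le> (\<Sum>i<n. \<Sum>j<n. (adj E i j - (if i = j then 0 else e i j)) * u i * v j)} =
      {E. l * (t + m) \<le> (\<Sum>i<n. \<Sum>j<n. c i j * adj E i j)}"
    unfolding split lin using l by auto
  then have "measure_pmf.prob (sbm n p q g)
      {E. t \<le> (\<Sum>i<n. \<Sum>j<n. (adj E i j - (if i = j then 0 else e i j)) * u i * v j)}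
    \<le> exp (- (l * (t + m)) + (\<Sum>i<n. \<Sum>j<i. e i j * (exp (c i j + c j i) - 1)))"
    using sbm_chernoff[of p q n g "l * (t + m)" c] pq by (simp add: e_def)
  also have "(\<Sum>i<n. \<Sum>j<i. e i j * (exp (c i j + c j i) - 1)) \<le>
      (\<Sum>i<n. \<Sum>j<i. e i j * (c i j + c j i) + (2 * P * (c i j)\<^sup>2 + 2 * P * (c j i)\<^sup>2))"
  proof (intro sum_mono)
    fix i j assume ij: "i \<in> {..<n}" "j \<in> {..<i}"
    have "\<bar>c i' j'\<bar> \<le> 1 / 2" if "i' < n" "j' < n" for i' j'
    proof -
      have "\<bar>c i' j'\<bar> = l * (\<bar>real_of_int (u i')\<bar> * \<bar>real_of_int (v j')\<bar>)"
        using l by (simp add: c_def abs_mult)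
      also have "\<dots> \<le> l * (B * B)"
        using l u(2)[OF that(1)] v(2)[OF that(2)] by (intro mult_left_mono mult_mono) auto
      finally show ?thesis using l by (simp add: power2_eq_square)
    qed
    from this[of i j] this[of j i] have "\<bar>c i j + c j i\<bar> \<le> 1" using ij by auto
    then have "exp (c i j + c j i) - 1 \<le> (c i j + c j i) + (c i j + c j i)\<^sup>2" by (rule exp_le_quadratic)
    then have "e i j * (exp (c i j + c j i) - 1) \<le> e i j * ((c i j + c j i) + (c i j + c j i)\<^sup>2)"
      by (intro mult_left_mono e)
    also have "\<dots> = e i j * (c i j + c j i) + e i j * (c i j + c j i)\<^sup>2"
      by (simp add: distrib_left)
    also have "e i j * (c i j + c j i)\<^sup>2 \<le> P * (2 * (c i j)\<^sup>2 + 2 * (c j i)\<^sup>2)"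
    proof (intro mult_mono e)
      show "(c i j + c j i)\<^sup>2 \<le> 2 * (c i j)\<^sup>2 + 2 * (c j i)\<^sup>2"
        using sum_squares_bound[of "c i j" "c j i"] by (simp add: power2_sum)
    qed (use pq in auto)
    finally show "e i j * (exp (c i j + c j i) - 1) \<le>
        e i j * (c i j + c j i) + (2 * P * (c i j)\<^sup>2 + 2 * P * (c j i)\<^sup>2)"
      by (simp add: algebra_simps)
  qed
  also have "\<dots> = l * m + (\<Sum>i<n. \<Sum>j<i. 2 * P * (c i j)\<^sup>2 + 2 * P * (c j i)\<^sup>2)"
    unfolding mean by (simp only: sum.distrib)
  also have "(\<Sum>i<n. \<Sum>j<i. 2 * P * (c i j)\<^sup>2 + 2 * P * (c j i)\<^sup>2) \<le> (\<Sum>i<n. \<Sum>j<n. 2 * P * (c i j)\<^sup>2)"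
    using pq by (intro sum_triangle_le_square) auto
  also have "\<dots> = 2 * P * l\<^sup>2 * ((\<Sum>i<n. (real_of_int (u i))\<^sup>2) * (\<Sum>j<n. (real_of_int (v j))\<^sup>2))"
    unfolding sum_product by (simp add: c_def sum_distrib_left power_mult_distrib mult_ac)
  also have "\<dots> \<le> 2 * P * l\<^sup>2 * ((4 * real n) * (4 * real n))"
  proof -
    have "(\<Sum>i<n. (real_of_int (w i))\<^sup>2) \<le> 4 * real n" if "(\<Sum>i<n. (w i)\<^sup>2) \<le> 4 * int n" for w :: "nat \<Rightarrow> int"
    proof -
      have "real_of_int (\<Sum>i<n. (w i)\<^sup>2) \<le> real_of_int (4 * int n)" using that by (simp only: of_int_le_iff)
      then show ?thesis by simp
    qed
    then show ?thesis using u(1) v(1) pq by (intro mult_left_mono mult_mono) (auto intro: sum_nonneg)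
  qed
  also have "- (l * (t + m)) + (l * m + 2 * P * l\<^sup>2 * ((4 * real n) * (4 * real n))) = - l * t + 32 * l\<^sup>2 * P * (real n)\<^sup>2"
    by (simp add: algebra_simps power2_eq_square)
  finally show ?thesis by (simp only: e_def exp_le_cancel_iff add_le_cancel_left)
qed

text \<open>
  Since \<open>\<bar>k\<bar> \<le> k\<^sup>2\<close>, the weight \<open>2\<close> to the power \<open>4 n - (\<Sum>i<n. \<bar>u i\<bar>)\<close> is at least \<open>1\<close> on the vectors to be
  counted, and its sum over all vectors factorises into one geometric series, below \<open>3\<close>, for each
  coordinate, whatever the size \<open>m\<close> of the box.
\<close>
lemma card_short_integer_vectors:
  "card {u \<in> {..<n} \<rightarrow>\<^sub>E {- int m..int m}. (\<Sum>i<n. (u i)\<^sup>2) \<le> 4 * int n} \<le> 48 ^ n"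
proof -
  define I where "I = {- int m..int m}"
  define A where "A = {u \<in> {..<n} \<rightarrow>\<^sub>E I. (\<Sum>i<n. (u i)\<^sup>2) \<le> 4 * int n}"
  have fin: "finite ({..<n} \<rightarrow>\<^sub>E I)" by (intro finite_PiE) (auto simp: I_def)
  have one: "1 \<le> 16 ^ n * (\<Prod>i<n. (1/2::real) ^ nat \<bar>u i\<bar>)" if "u \<in> A" for u
  proof -
    have "int (\<Sum>i<n. nat \<bar>u i\<bar>) = (\<Sum>i<n. \<bar>u i\<bar>)" by simp
    also have "\<dots> \<le> (\<Sum>i<n. (u i)\<^sup>2)"
    proof (rule sum_mono)
      show "\<bar>u i\<bar> \<le> (u i)\<^sup>2" for i
        using self_le_power[of "\<bar>u i\<bar>" 2] by (cases "u i = 0") auto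
    qed
    also have "\<dots> \<le> int (4 * n)" using that by (simp add: A_def)
    finally have "(\<Sum>i<n. nat \<bar>u i\<bar>) \<le> 4 * n" by (simp only: of_nat_le_iff)
    then have "(1/2::real) ^ (4 * n) \<le> (1/2) ^ (\<Sum>i<n. nat \<bar>u i\<bar>)"
      by (intro power_decreasing) auto
    then have "16 ^ n * (1/2::real) ^ (4 * n) \<le> 16 ^ n * (\<Prod>i<n. (1/2::real) ^ nat \<bar>u i\<bar>)"
      by (simp add: power_sum)
    moreover have "16 ^ n * (1/2::real) ^ (4 * n) = 1"
      by (simp add: power_mult power_one_over)
    ultimately show ?thesis by simp
  qed
  have geom: "(\<Sum>k\<in>{- int m..int m}. (1/2::real) ^ nat \<bar>k\<bar>) = 3 - 2 * (1/2) ^ m" for m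
  proof (induction m)
    case (Suc m)
    have "{- int (Suc m)..int (Suc m)} = insert (- int (Suc m)) (insert (int (Suc m)) {- int m..int m})"
      by auto
    then have "(\<Sum>k\<in>{- int (Suc m)..int (Suc m)}. (1/2::real) ^ nat \<bar>k\<bar>) =
      (1/2) ^ Suc m + ((1/2) ^ Suc m + (\<Sum>k\<in>{- int m..int m}. (1/2::real) ^ nat \<bar>k\<bar>))"
      by (simp add: nat_add_distrib)
    then show ?case using Suc by simp
  qed simp
  have "real (card A) = (\<Sum>u\<in>A. 1)" by simp
  also have "\<dots> \<le> (\<Sum>u\<in>A. 16 ^ n * (\<Prod>i<n. (1/2::real) ^ nat \<bar>u i\<bar>))" by (intro sum_mono one)
  also have "\<dots> \<le> (\<Sum>u\<in>{..<n} \<rightarrow>\<^sub>E I. 16 ^ n * (\<Prod>i<n. (1/2::real) ^ nat \<bar>u i\<bar>))"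
    using fin by (intro sum_mono2) (auto simp: A_def prod_nonneg)
  also have "\<dots> = 16 ^ n * (\<Prod>i<n. \<Sum>k\<in>I. (1/2::real) ^ nat \<bar>k\<bar>)"
    by (subst prod_sum_PiE) (auto simp: I_def sum_distrib_left)
  also have "\<dots> \<le> 16 ^ n * (\<Prod>i<n. 3)"
    unfolding I_def geom using power_le_one[of "1/2::real" m] by (intro mult_left_mono prod_mono) auto
  also have "\<dots> = real (48 ^ n)" by (simp flip: power_mult_distrib)
  finally show ?thesis unfolding A_def I_def by (simp only: of_nat_le_iff)
qed

section \<open>From tail bounds to exact recovery\<close>

lemma prob_Bex_le:
  assumes "finite I" and "\<And>x. x \<in> I \<Longrightarrow> measure_pmf.prob M {E. B x E} \<le> b x"
  shows "measure_pmf.prob M {E. \<exists>x\<in>I. B x E} \<le> sum b I"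
proof -
  have "measure_pmf.prob M {E. \<exists>x\<in>I. B x E} = measure_pmf.prob M (\<Union>x\<in>I. {E. B x E})"
    by (intro arg_cong[where f = "measure_pmf.prob M"]) auto
  also have "\<dots> \<le> (\<Sum>x\<in>I. measure_pmf.prob M {E. B x E})"
    using assms(1) by (intro measure_pmf.finite_measure_subadditive_finite) auto
  also have "\<dots> \<le> sum b I" by (intro sum_mono assms(2))
  finally show ?thesis .
qed

text \<open>
  The exponential scale \<open>\<theta>\<close> may grow with \<open>n\<close>, and this is what makes small sets much sparser than
  the whole graph.  With \<open>d = ln n\<close>, \<open>P\<close> of order \<open>d / n\<close>, and \<open>s\<close> and \<open>k\<close> of order \<open>d\<close>, the choice
  \<open>exp \<theta> = d\<close> bounds the moment generating function of a set of size \<open>m \<le> n / s\<close> by \<open>exp (O(d m))\<close>,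
  whereas the gain \<open>exp (- \<theta> k m / 2)\<close> has \<open>d m ln d\<close> in the exponent and beats the number of such
  sets, at most \<open>n ^ m = exp (d m)\<close>.  With a failure probability of at most \<open>n\<close> to the power \<open>- 2 m\<close> for each set, the sum over all nonempty sets is at
  most \<open>(1 + 1 / n) ^ n / n\<close>.
\<close>
lemma sparsity_failure_prob:
  fixes p q P s k \<theta> :: real
  assumes pq: "0 \<le> p" "p \<le> P" "0 \<le> q" "q \<le> P" "P \<le> 1" and n: "n > 0" and \<theta>: "\<theta> \<ge> 0" and s: "s > 0"
    and rate: "P * exp \<theta> * n / (2 * s) + 2 * ln n \<le> \<theta> * k / 2"
  shows "measure_pmf.prob (sbm n p q g) {E. \<exists>S. S \<subseteq> {..<n} \<and> S \<noteq> {} \<and> card S * s \<le> n \<and>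
      k * card S < (\<Sum>i\<in>S. \<Sum>j\<in>S. adj E i j)} \<le> 3 / n"
proof -
  define I where "I = {S. S \<subseteq> {..<n} \<and> S \<noteq> {} \<and> card S * s \<le> n}"
  have fin: "finite I" by (rule finite_subset[of _ "Pow {..<n}"]) (auto simp: I_def)
  have tail: "measure_pmf.prob (sbm n p q g) {E. k * card S < (\<Sum>i\<in>S. \<Sum>j\<in>S. adj E i j)} \<le> (1 / n) * (1 / n) ^ card S"
    if S: "S \<in> I" for S
  proof -
    have card: "card S \<ge> 1" using S finite_subset[of S "{..<n}"] by (auto simp: I_def Suc_le_eq card_gt_0_iff)
    have "measure_pmf.prob (sbm n p q g) {E. k * card S < (\<Sum>i\<in>S. \<Sum>j\<in>S. adj E i j)}
        \<le> measure_pmf.prob (sbm n p q g) {E. k * card S \<le> (\<Sum>i\<in>S. \<Sum>j\<in>S. adj E i j)}"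
      by (intro measure_pmf.finite_measure_mono) auto
    also have "\<dots> \<le> exp (- \<theta> * (k * card S) / 2 + P * exp \<theta> * (card S)\<^sup>2 / 2)"
      using S by (intro edges_within_tail pq \<theta>) (auto simp: I_def)
    also have "\<dots> \<le> exp (- 2 * ln n * card S)"
    proof -
      have "card S \<le> n / s" using S s by (simp add: I_def field_simps)
      then have "P * exp \<theta> / 2 * card S * card S \<le> P * exp \<theta> / 2 * card S * (n / s)"
        using pq by (intro mult_left_mono) auto
      also have "\<dots> = P * exp \<theta> * n / (2 * s) * card S" by simp
      also have "\<dots> \<le> (\<theta> * k / 2 - 2 * ln n) * card S"
        using rate by (intro mult_right_mono) auto
      finally show ?thesis by (simp add: power2_eq_square algebra_simps)
    qed
    also have "\<dots> = (1 / n) ^ (card S + card S)"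
    proof -
      have "- 2 * ln n * card S = real (card S + card S) * ln (1 / n)"
      proof -
        have z: "ln (1 / real n) = - ln n" using n by (simp add: ln_div)
        show ?thesis unfolding z by (simp add: algebra_simps)
      qed
      then have "exp (- 2 * ln n * card S) = exp (ln (1 / n)) ^ (card S + card S)"
        by (simp only: exp_of_nat_mult)
      then show ?thesis using n by simp
    qed
    also have "\<dots> \<le> (1 / n) ^ (1 + card S)"
      using card n by (intro power_decreasing) auto
    finally show ?thesis by simp
  qed
  have "measure_pmf.prob (sbm n p q g) {E. \<exists>S\<in>I. k * card S < (\<Sum>i\<in>S. \<Sum>j\<in>S. adj E i j)} \<le>
      (\<Sum>S\<in>I. (1 / n) * (1 / n) ^ card S)"
    by (intro prob_Bex_le fin tail)
  also have "\<dots> \<le> (\<Sum>S\<in>Pow {..<n}. (1 / n) * (1 / n) ^ card S)"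
    by (intro sum_mono2) (auto simp: I_def)
  also have "\<dots> = (1 / n) * (1 / n + 1) ^ n"
    using prod_add[of "{..<n}" "\<lambda>_. 1 / real n" "\<lambda>_. 1"] by (simp add: sum_distrib_left)
  also have "\<dots> \<le> (1 / n) * exp 1"
  proof -
    have "(1 / n + 1) ^ n \<le> exp (1 / n) ^ n"
      by (intro power_mono) (auto simp: add.commute exp_ge_add_one_self)
    also have "\<dots> = exp 1" using n by (simp flip: exp_of_nat_mult)
    finally show ?thesis by (intro mult_left_mono) auto
  qed
  also have "\<dots> \<le> (1 / n) * 3" by (intro mult_left_mono exp_le) auto
  finally show ?thesis by (simp add: I_def conj_ac Bex_def)
qed

text \<open>
  Union bound over two integer vectors, each with at most \<open>48 ^ n \<le> exp (6 * n)\<close> possible values on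
  \<open>{..<n}\<close>.
\<close>
lemma discrete_form_failure_prob:
  fixes p q P B l \<tau> :: real
  assumes pq: "0 \<le> p" "p \<le> P" "0 \<le> q" "q \<le> P" "P \<le> 1" and l: "l > 0" "2 * l * B\<^sup>2 \<le> 1"
  shows "measure_pmf.prob (sbm n p q g) {E. \<exists>u v :: nat \<Rightarrow> int.
      (\<Sum>i<n. (u i)\<^sup>2) \<le> 4 * int n \<and> (\<Sum>i<n. (v i)\<^sup>2) \<le> 4 * int n \<and>
      (\<forall>i<n. \<bar>real_of_int (u i)\<bar> \<le> B) \<and> (\<forall>i<n. \<bar>real_of_int (v i)\<bar> \<le> B) \<and>
      \<tau> * n < (\<Sum>i<n. \<Sum>j<n. (adj E i j - (if i = j then 0 else edge_prob p q g {i, j})) * u i * v j)}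
    \<le> exp (12 * real n - l * \<tau> * n + 32 * l\<^sup>2 * P * (real n)\<^sup>2)"
proof -
  define m where "m = nat \<lfloor>B\<rfloor>"
  define A where "A = {u \<in> {..<n} \<rightarrow>\<^sub>E {- int m..int m}. (\<Sum>i<n. (u i)\<^sup>2) \<le> 4 * int n}"
  define A' where "A' = {u \<in> A. \<forall>i<n. \<bar>real_of_int (u i)\<bar> \<le> B}"
  define F where "F = (\<lambda>E (u :: nat \<Rightarrow> int) (v :: nat \<Rightarrow> int).
    (\<Sum>i<n. \<Sum>j<n. (adj E i j - (if i = j then 0 else edge_prob p q g {i, j})) * u i * v j))"
  have fin: "finite A" unfolding A_def by (simp add: finite_PiE)
  have fin': "finite A'" using fin by (simp add: A'_def)
  have restr: "restrict u {..<n} \<in> A'"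
    if "(\<Sum>i<n. (u i)\<^sup>2) \<le> 4 * int n" "\<forall>i<n. \<bar>real_of_int (u i)\<bar> \<le> B" for u :: "nat \<Rightarrow> int"
  proof -
    have "u i \<in> {- int m..int m}" if "i < n" for i
    proof -
      have "real_of_int \<bar>u i\<bar> \<le> B" using \<open>\<forall>i<n. _\<close> that by simp
      then have "\<bar>u i\<bar> \<le> \<lfloor>B\<rfloor>" by (simp only: le_floor_iff)
      moreover from this have "0 \<le> \<lfloor>B\<rfloor>" by linarith
      ultimately show ?thesis by (auto simp: m_def)
    qed
    then show ?thesis using that by (simp add: A'_def A_def)
  qed
  have F_restr: "F E (restrict u {..<n}) (restrict v {..<n}) = F E u v" for E u v
    unfolding F_def by (intro sum.cong refl) simp
  have sub: "{E. \<exists>u v :: nat \<Rightarrow> int.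
      (\<Sum>i<n. (u i)\<^sup>2) \<le> 4 * int n \<and> (\<Sum>i<n. (v i)\<^sup>2) \<le> 4 * int n \<and>
      (\<forall>i<n. \<bar>real_of_int (u i)\<bar> \<le> B) \<and> (\<forall>i<n. \<bar>real_of_int (v i)\<bar> \<le> B) \<and> \<tau> * n < F E u v}
    \<subseteq> {E. \<exists>w\<in>A' \<times> A'. \<tau> * n < F E (fst w) (snd w)}"
  proof safe
    fix E and u v :: "nat \<Rightarrow> int"
    assume *: "(\<Sum>i<n. (u i)\<^sup>2) \<le> 4 * int n" "(\<Sum>i<n. (v i)\<^sup>2) \<le> 4 * int n"
      "\<forall>i<n. \<bar>real_of_int (u i)\<bar> \<le> B" "\<forall>i<n. \<bar>real_of_int (v i)\<bar> \<le> B" "\<tau> * n < F E u v"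
    show "\<exists>w\<in>A' \<times> A'. \<tau> * n < F E (fst w) (snd w)"
      using * restr[of u] restr[of v] F_restr[of E u v]
      by (intro bexI[of _ "(restrict u {..<n}, restrict v {..<n})"]) auto
  qed
  have tail: "measure_pmf.prob (sbm n p q g) {E. \<tau> * n < F E (fst w) (snd w)} \<le>
      exp (- l * (\<tau> * n) + 32 * l\<^sup>2 * P * (real n)\<^sup>2)" if "w \<in> A' \<times> A'" for w
  proof -
    have "measure_pmf.prob (sbm n p q g) {E. \<tau> * n < F E (fst w) (snd w)} \<le>
        measure_pmf.prob (sbm n p q g) {E. \<tau> * n \<le> F E (fst w) (snd w)}"
      by (intro measure_pmf.finite_measure_mono) auto
    also have "\<dots> \<le> exp (- l * (\<tau> * n) + 32 * l\<^sup>2 * P * (real n)\<^sup>2)"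
      unfolding F_def using that by (intro bilinear_form_tail[OF pq _ _ _ _ l]) (auto simp: A'_def A_def)
    finally show ?thesis .
  qed
  have card: "real (card A') \<le> exp (6 * n)"
  proof -
    have "card A' \<le> card A" using fin by (intro card_mono) (auto simp: A'_def)
    also have "\<dots> \<le> 48 ^ n" unfolding A_def by (rule card_short_integer_vectors)
    finally have "real (card A') \<le> real (48 ^ n)" by (simp only: of_nat_le_iff)
    also have "real (48 ^ n) \<le> (2 ^ 6) ^ n" by (simp add: power_mono)
    also have "\<dots> \<le> (exp 1 ^ 6) ^ n"
      using exp_ge_add_one_self[of "1::real"] by (intro power_mono) auto
    also have "\<dots> = exp (6 * n)" by (simp flip: exp_of_nat_mult power_mult)
    finally show ?thesis .
  qed
  have "measure_pmf.prob (sbm n p q g) {E. \<exists>w\<in>A' \<times> A'. \<tau> * n < F E (fst w) (snd w)} \<le>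
      (\<Sum>w\<in>A' \<times> A'. exp (- l * (\<tau> * n) + 32 * l\<^sup>2 * P * (real n)\<^sup>2))"
    by (intro prob_Bex_le tail finite_cartesian_product fin')
  also have "\<dots> = real (card A') * real (card A') * exp (- l * (\<tau> * n) + 32 * l\<^sup>2 * P * (real n)\<^sup>2)"
    by (simp add: card_cartesian_product)
  also have "\<dots> \<le> exp (6 * n) * exp (6 * n) * exp (- l * (\<tau> * n) + 32 * l\<^sup>2 * P * (real n)\<^sup>2)"
    using card by (intro mult_right_mono mult_mono) auto
  also have "\<dots> = exp (12 * real n - l * \<tau> * n + 32 * l\<^sup>2 * P * (real n)\<^sup>2)"
    by (simp flip: exp_add add: mult_ac)
  finally show ?thesis
    using measure_pmf.finite_measure_mono[OF sub, of "sbm n p q g"] by (simp add: F_def)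
qed

text \<open>
  For \<open>x\<close> orthogonal to the sign vector the mean of the adjacency form is
  \<open>(p + q) / 2 * (\<Sum>i<n. x i)\<^sup>2 - p * (\<Sum>i<n. (x i)\<^sup>2)\<close>, which the all-ones part of the certificate absorbs.
  What is left is the margin against the fluctuation.
\<close>
lemma sdp_recovery_if_margin_exceeds_fluctuation:
  fixes p q b t :: real
  assumes pq: "0 \<le> p" "0 \<le> q" "p + q \<le> 1" and g: "balanced_partition n g" and n: "n > 0"
    and fluct: "\<And>x :: nat \<Rightarrow> real. (\<Sum>i<n. (x i)\<^sup>2) \<le> n \<Longrightarrow>
      (\<Sum>i<n. \<Sum>j<n. (adj E i j - (if i = j then 0 else edge_prob p q g {i, j})) * x i * x j) \<le> b * n"
    and margin: "\<And>i. i < n \<Longrightarrow> t < (\<Sum>j<n. adj E i j * vec_index g i * vec_index g j)"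
    and bt: "b \<le> t"
  shows "sdp_solutions n (adjacency_matrix n E) = {outer_prod g g}"
proof -
  define \<gamma> where "\<gamma> = vec_index g"
  define e where "e = (\<lambda>i j. edge_prob p q g {i, j})"
  have signs: "\<gamma> i = 1 \<or> \<gamma> i = -1" if "i < n" for i
    using g that by (auto simp: balanced_partition_def \<gamma>_def)
  have e: "e i j = (p + q) / 2 + (p - q) / 2 * \<gamma> i * \<gamma> j" if "i < n" "j < n" for i j
    using signs[OF that(1)] signs[OF that(2)] by (auto simp: e_def edge_prob_pair simp flip: \<gamma>_def) (simp_all add: field_simps)
  have "0 < 2 * (\<Sum>i<n. (\<Sum>j<n. adj E i j * \<gamma> i * \<gamma> j) * (x i)\<^sup>2)
        - 2 * (\<Sum>i<n. \<Sum>j<n. adj E i j * x i * x j) + (\<Sum>i<n. x i)\<^sup>2"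
    if orth: "(\<Sum>i<n. \<gamma> i * x i) = 0" and nz: "\<exists>i<n. x i \<noteq> 0" for x
  proof -
    define N where "N = (\<Sum>i<n. (x i)\<^sup>2)"
    obtain k where k: "k < n" "x k \<noteq> 0" using nz by blast
    have N: "N > 0" unfolding N_def using k by (intro sum_pos2[of _ k]) auto
    define y where "y = (\<lambda>i. sqrt (n / N) * x i)"
    have sq: "sqrt (n / N) * sqrt (n / N) = n / N" using N by simp
    have "(\<Sum>i<n. (y i)\<^sup>2) = n / N * N"
      unfolding y_def N_def[symmetric] power_mult_distrib sum_distrib_left[symmetric] using N by simp
    then have "(\<Sum>i<n. \<Sum>j<n. (adj E i j - (if i = j then 0 else e i j)) * y i * y j) \<le> b * n"
      using fluct[of y] N unfolding e_def by simp
    also have "(\<Sum>i<n. \<Sum>j<n. (adj E i j - (if i = j then 0 else e i j)) * y i * y j) =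
        n / N * (\<Sum>i<n. \<Sum>j<n. (adj E i j - (if i = j then 0 else e i j)) * x i * x j)"
    proof -
      have "a * y i * y j = n / N * (a * x i * x j)" for a i j
      proof -
        have "a * y i * y j = sqrt (n / N) * sqrt (n / N) * (a * x i * x j)"
          by (simp only: y_def mult_ac)
        then show ?thesis by (simp only: sq)
      qed
      then show ?thesis unfolding sum_distrib_left by (simp only:)
    qed
    finally have scaled: "(\<Sum>i<n. \<Sum>j<n. (adj E i j - (if i = j then 0 else e i j)) * x i * x j) \<le> b * N"
      using N n by (simp add: field_simps)
    have mean: "(\<Sum>i<n. \<Sum>j<n. (if i = j then 0 else e i j) * x i * x j) = (p + q) / 2 * (\<Sum>i<n. x i)\<^sup>2 - p * N"
    proof -
      have "(\<Sum>i<n. \<Sum>j<n. (if i = j then 0 else e i j) * x i * x j) =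
        (\<Sum>i<n. \<Sum>j<n. (p + q) / 2 * (x i * x j) + (p - q) / 2 * ((\<gamma> i * x i) * (\<gamma> j * x j)) - (if i = j then p * (x i)\<^sup>2 else 0))"
      proof (intro sum.cong refl)
        fix i j assume "i \<in> {..<n}" "j \<in> {..<n}"
        then have "e i j * (x i * x j) = (p + q) / 2 * (x i * x j) + (p - q) / 2 * ((\<gamma> i * x i) * (\<gamma> j * x j))"
          by (simp add: e algebra_simps)
        moreover have "e i i = p" by (simp add: e_def edge_prob_def)
        ultimately show "(if i = j then 0 else e i j) * x i * x j =
          (p + q) / 2 * (x i * x j) + (p - q) / 2 * ((\<gamma> i * x i) * (\<gamma> j * x j)) - (if i = j then p * (x i)\<^sup>2 else 0)"
          by (auto simp: power2_eq_square mult.assoc)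
      qed
      also have "\<dots> = (p + q) / 2 * (\<Sum>i<n. x i)\<^sup>2 + (p - q) / 2 * ((\<Sum>i<n. \<gamma> i * x i) * (\<Sum>i<n. \<gamma> i * x i)) - p * N"
        unfolding power2_eq_square[of "sum _ _"] sum_product N_def
        by (simp add: sum.distrib sum_subtractf sum_distrib_left)
      finally show ?thesis by (simp add: orth)
    qed
    have "(\<Sum>i<n. \<Sum>j<n. adj E i j * x i * x j) =
        (\<Sum>i<n. \<Sum>j<n. (adj E i j - (if i = j then 0 else e i j)) * x i * x j) +
        (\<Sum>i<n. \<Sum>j<n. (if i = j then 0 else e i j) * x i * x j)"
      unfolding sum.distrib[symmetric] by (intro sum.cong refl) (simp add: algebra_simps)
    also have "\<dots> \<le> b * N + (p + q) / 2 * (\<Sum>i<n. x i)\<^sup>2"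
      using scaled N pq unfolding mean by (simp add: add_mono)
    also have "(p + q) / 2 * (\<Sum>i<n. x i)\<^sup>2 \<le> 1 / 2 * (\<Sum>i<n. x i)\<^sup>2"
      using pq by (intro mult_right_mono) auto
    finally have "2 * (\<Sum>i<n. \<Sum>j<n. adj E i j * x i * x j) \<le> 2 * (b * N) + (\<Sum>i<n. x i)\<^sup>2" by simp
    moreover have "t * N < (\<Sum>i<n. (\<Sum>j<n. adj E i j * \<gamma> i * \<gamma> j) * (x i)\<^sup>2)"
    proof -
      have "(\<Sum>i<n. t * (x i)\<^sup>2) < (\<Sum>i<n. (\<Sum>j<n. adj E i j * \<gamma> i * \<gamma> j) * (x i)\<^sup>2)"
      proof (rule sum_strict_mono_ex1)
        show "\<forall>i\<in>{..<n}. t * (x i)\<^sup>2 \<le> (\<Sum>j<n. adj E i j * \<gamma> i * \<gamma> j) * (x i)\<^sup>2"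
          using margin unfolding \<gamma>_def by (intro ballI mult_right_mono) (auto intro: less_imp_le)
        show "\<exists>i\<in>{..<n}. t * (x i)\<^sup>2 < (\<Sum>j<n. adj E i j * \<gamma> i * \<gamma> j) * (x i)\<^sup>2"
          using margin[OF k(1)] k unfolding \<gamma>_def by (intro bexI[of _ k] mult_strict_right_mono) auto
      qed simp
      then show ?thesis by (simp add: N_def sum_distrib_left)
    qed
    moreover have "b * N \<le> t * N" using bt N by (intro mult_right_mono) auto
    ultimately show ?thesis by linarith
  qed
  then have "sdp_solutions n (Matrix.mat n n (\<lambda>(i, j). adj E i j)) = {outer_prod g g}"
    unfolding \<gamma>_def by (intro sdp_dual_certificate g n) (auto simp: adj_def insert_commute)
  moreover have "adjacency_matrix n E = Matrix.mat n n (\<lambda>(i, j). adj E i j)"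
    by (simp add: adjacency_matrix_def adj_def)
  ultimately show ?thesis by simp
qed

text \<open>
  The four failure terms belong to a node of large degree, a small set with many inner edges, a
  large value of the fluctuation form on integer vectors, and a node of small margin.  The integer
  vectors come from rounding vectors with entries up to \<open>R\<close>, so theirs are at most \<open>R + 1 \<le> 2 R\<close>.
\<close>
lemma sdp_recovery_probability:
  fixes p q P \<Delta> k \<eta> R l \<tau> \<mu> \<theta> \<phi> t :: real
  assumes pq: "0 \<le> p" "p \<le> P" "0 \<le> q" "q \<le> P" "P \<le> 1" "p + q \<le> 1"
    and g: "balanced_partition n g" and n: "n > 0"
    and R: "R \<ge> 1" and \<eta>: "0 < \<eta>" "\<eta> \<le> 1" and l: "l > 0" and k: "k \<ge> 0" and \<Delta>: "\<Delta> \<ge> 0"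
    and \<theta>: "\<theta> > 0" and \<phi>: "\<phi> \<ge> 0" and \<mu>: "\<mu> > 0" "8 * \<mu> * R\<^sup>2 \<le> 1"
    and sparse: "P * exp \<phi> * n / (2 * (\<eta> * R)\<^sup>2) + 2 * ln n \<le> \<phi> * k / 2"
    and bt: "\<tau> + l * k + \<Delta> / l + 2 * \<eta> * \<Delta> + 2 * P * n / R \<le> t"
  shows "measure_pmf.prob (sbm n p q g) {E. sdp_solutions n (adjacency_matrix n E) = {outer_prod g g}}
    \<ge> 1 - (n * exp (- \<Delta> + 2 * P * n) + 3 / n + exp (12 * real n - \<mu> * \<tau> * n + 32 * \<mu>\<^sup>2 * P * (real n)\<^sup>2)
       + n * exp (\<theta> * t + n / 2 * (p * (exp (- \<theta>) - 1) + q * (exp \<theta> - 1)) + 1))"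
proof -
  let ?M = "sbm n p q g"
  define F where "F = (\<lambda>E (u :: nat \<Rightarrow> real) (v :: nat \<Rightarrow> real).
    (\<Sum>i<n. \<Sum>j<n. (adj E i j - (if i = j then 0 else edge_prob p q g {i, j})) * u i * v j))"
  define D where "D = {E. \<exists>i\<in>{..<n}. \<Delta> \<le> (\<Sum>j<n. adj E i j)}"
  define S where "S = {E. \<exists>S. S \<subseteq> {..<n} \<and> S \<noteq> {} \<and> card S * (\<eta> * R)\<^sup>2 \<le> n \<and>
      k * card S < (\<Sum>i\<in>S. \<Sum>j\<in>S. adj E i j)}"
  define L where "L = {E. \<exists>u v :: nat \<Rightarrow> int.
      (\<Sum>i<n. (u i)\<^sup>2) \<le> 4 * int n \<and> (\<Sum>i<n. (v i)\<^sup>2) \<le> 4 * int n \<and>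
      (\<forall>i<n. \<bar>real_of_int (u i)\<bar> \<le> R + 1) \<and> (\<forall>i<n. \<bar>real_of_int (v i)\<bar> \<le> R + 1) \<and> \<tau> * n < F E u v}"
  define T where "T = {E. \<exists>i\<in>{..<n}. (\<Sum>j<n. adj E i j * vec_index g i * vec_index g j) \<le> t}"
  have probD: "measure_pmf.prob ?M D \<le> n * exp (- \<Delta> + 2 * P * n)"
  proof -
    have "measure_pmf.prob ?M D \<le> (\<Sum>i<n. exp (- \<Delta> + 2 * P * n))"
      unfolding D_def using pq by (intro prob_Bex_le degree_tail) auto
    then show ?thesis by simp
  qed
  have probS: "measure_pmf.prob ?M S \<le> 3 / n"
    unfolding S_def using pq n \<eta> R by (intro sparsity_failure_prob[OF _ _ _ _ _ _ \<phi> _ sparse]) auto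
  have probL: "measure_pmf.prob ?M L \<le> exp (12 * real n - \<mu> * \<tau> * n + 32 * \<mu>\<^sup>2 * P * (real n)\<^sup>2)"
  proof -
    have "(R + 1)\<^sup>2 \<le> (2 * R)\<^sup>2" using R by (intro power_mono) auto
    then have "2 * \<mu> * (R + 1)\<^sup>2 \<le> 2 * \<mu> * (4 * R\<^sup>2)"
      using \<mu> by (intro mult_left_mono) (auto simp: power_mult_distrib)
    then have "2 * \<mu> * (R + 1)\<^sup>2 \<le> 1" using \<mu>(2) by linarith
    from discrete_form_failure_prob[OF pq(1-5) \<mu>(1) this] show ?thesis
      unfolding L_def F_def .
  qed
  have probT: "measure_pmf.prob ?M T \<le> n * exp (\<theta> * t + n / 2 * (p * (exp (- \<theta>) - 1) + q * (exp \<theta> - 1)) + 1)"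
  proof -
    have "measure_pmf.prob ?M T \<le> (\<Sum>i<n. exp (\<theta> * t + n / 2 * (p * (exp (- \<theta>) - 1) + q * (exp \<theta> - 1)) + 1))"
      unfolding T_def using pq by (intro prob_Bex_le margin_tail g \<theta>) auto
    then show ?thesis by simp
  qed
  have good: "sdp_solutions n (adjacency_matrix n E) = {outer_prod g g}" if E: "E \<notin> D \<union> S \<union> L \<union> T" for E
  proof (rule sdp_recovery_if_margin_exceeds_fluctuation[OF pq(1,3,6) g n _ _ bt])
    fix x :: "nat \<Rightarrow> real"
    assume x: "(\<Sum>i<n. (x i)\<^sup>2) \<le> n"
    show "(\<Sum>i<n. \<Sum>j<n. (adj E i j - (if i = j then 0 else edge_prob p q g {i, j})) * x i * x j) \<le>
      (\<tau> + l * k + \<Delta> / l + 2 * \<eta> * \<Delta> + 2 * P * n / R) * n"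
    proof (rule fluctuation_form_bound[OF _ _ _ _ _ _ _ _ x])
      show "(\<Sum>j<n. adj E i j) \<le> \<Delta>" if "i < n" for i
        using E that by (force simp: D_def)
      show "(\<Sum>i\<in>S. \<Sum>j\<in>S. adj E i j) \<le> k * card S"
        if "S \<subseteq> {..<n}" "S \<noteq> {}" "card S * (\<eta> * R)\<^sup>2 \<le> n" for S
        using E that by (force simp: S_def)
      show "(\<Sum>i<n. \<Sum>j<n. (adj E i j - (if i = j then 0 else edge_prob p q g {i, j})) * u i * v j) \<le> \<tau> * n"
        if "(\<Sum>i<n. (u i)\<^sup>2) \<le> 4 * int n" "(\<Sum>i<n. (v i)\<^sup>2) \<le> 4 * int n"
          "\<And>i. i < n \<Longrightarrow> \<bar>real_of_int (u i)\<bar> \<le> R + 1" "\<And>i. i < n \<Longrightarrow> \<bar>real_of_int (v i)\<bar> \<le> R + 1" for u v :: "nat \<Rightarrow> int"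
      proof -
        have "E \<notin> L" using E by blast
        then have "\<not> \<tau> * n < F E u v" unfolding L_def using that by blast
        then show ?thesis by (simp add: F_def)
      qed
    qed (use pq R \<eta> l k \<Delta> in \<open>auto simp: adj_def edge_prob_def insert_commute\<close>)
  next
    show "t < (\<Sum>j<n. adj E i j * vec_index g i * vec_index g j)" if "i < n" for i
      using E that by (force simp: T_def)
  qed
  have "measure_pmf.prob ?M (- {E. sdp_solutions n (adjacency_matrix n E) = {outer_prod g g}})
      \<le> measure_pmf.prob ?M (D \<union> S \<union> L \<union> T)"
    using good by (intro measure_pmf.finite_measure_mono) auto
  also have "\<dots> \<le> measure_pmf.prob ?M D + measure_pmf.prob ?M S + measure_pmf.prob ?M L + measure_pmf.prob ?M T"
    by (intro order_trans[OF measure_Un_le] add_mono order_refl) auto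
  finally have "measure_pmf.prob ?M (- {E. sdp_solutions n (adjacency_matrix n E) = {outer_prod g g}}) \<le>
    n * exp (- \<Delta> + 2 * P * n) + 3 / n + exp (12 * real n - \<mu> * \<tau> * n + 32 * \<mu>\<^sup>2 * P * (real n)\<^sup>2)
       + n * exp (\<theta> * t + n / 2 * (p * (exp (- \<theta>) - 1) + q * (exp \<theta> - 1)) + 1)"
    using probD probS probL probT by linarith
  moreover have "measure_pmf.prob ?M (- {E. sdp_solutions n (adjacency_matrix n E) = {outer_prod g g}}) =
      1 - measure_pmf.prob ?M {E. sdp_solutions n (adjacency_matrix n E) = {outer_prod g g}}"
    using measure_pmf.prob_compl[of "{E. sdp_solutions n (adjacency_matrix n E) = {outer_prod g g}}" ?M]
    by (simp add: Compl_eq_Diff_UNIV)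
  ultimately show ?thesis by linarith
qed

section \<open>The logarithmic regime\<close>

text \<open>
  The minimum over \<open>\<theta>\<close> is \<open>- (sqrt \<alpha> - sqrt \<beta>)\<^sup>2 / 2\<close>, attained at \<open>exp \<theta> = sqrt \<alpha> / sqrt \<beta>\<close>.  For
  \<open>\<beta> = 0\<close> it is only the limit \<open>- \<alpha> / 2\<close> for large \<open>\<theta>\<close>, so that a value of \<open>exp (- \<theta>)\<close> below \<open>1 - 2 / \<alpha>\<close>
  is taken instead.
\<close>
lemma chernoff_exponent_below_minus_one:
  fixes \<alpha> \<beta> :: real
  assumes "\<alpha> > \<beta>" "\<beta> \<ge> 0" "sqrt \<alpha> - sqrt \<beta> > sqrt 2"
  obtains \<theta> where "\<theta> > 0" "(\<alpha> * (exp (- \<theta>) - 1) + \<beta> * (exp \<theta> - 1)) / 2 < -1"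
proof (cases "\<beta> = 0")
  case True
  then have \<alpha>: "\<alpha> > 2" using assms by simp
  define y where "y = (1 - 2 / \<alpha>) / 2"
  have y: "0 < y" "y < 1" "y < 1 - 2 / \<alpha>" using \<alpha> by (auto simp: y_def field_simps)
  have "\<alpha> * (y - 1) < \<alpha> * (- 2 / \<alpha>)" using \<alpha> y by (intro mult_strict_left_mono) auto
  then have "\<alpha> * (y - 1) < - 2" using \<alpha> by simp
  then show ?thesis using y True by (intro that[of "- ln y"]) auto
next
  case False
  define a b where "a = sqrt \<alpha>" and "b = sqrt \<beta>"
  have ab: "b > 0" "a > b" "\<alpha> = a * a" "\<beta> = b * b" "a - b > sqrt 2"
    using assms False by (auto simp: a_def b_def)
  have "sqrt 2 * sqrt 2 < (a - b) * (a - b)" using ab by (intro mult_strict_mono) auto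
  then have "2 < (a - b) * (a - b)" by simp
  moreover have "\<alpha> * (exp (- ln (a / b)) - 1) + \<beta> * (exp (ln (a / b)) - 1) = - ((a - b) * (a - b))"
    using ab by (simp add: exp_minus field_simps)
  ultimately show ?thesis using ab by (intro that[of "ln (a / b)"]) auto
qed

theorem corollary4p12:
  fixes \<alpha> \<beta> :: real
  assumes "\<alpha> > \<beta>" and "\<beta> \<ge> 0"
    and "sqrt \<alpha> - sqrt \<beta> > sqrt 2"
  shows "\<exists>\<kappa>>0. \<forall>\<^sub>F n in sequentially. even n \<longrightarrow>
           (\<forall>g. balanced_partition n g \<longrightarrow>
             measure_pmf.prob (sbm n (\<alpha> * ln (real n) / real n) (\<beta> * ln (real n) / real n) g)
               {E. sdp_solutions n (adjacency_matrix n E) = {outer_prod g g}}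
             \<ge> 1 - real n powr (- \<kappa>))"
proof -
  have \<alpha>: "\<alpha> > 0" using assms by linarith
  obtain \<theta> where \<theta>: "\<theta> > 0" "(\<alpha> * (exp (- \<theta>) - 1) + \<beta> * (exp \<theta> - 1)) / 2 < -1"
    using chernoff_exponent_below_minus_one[OF assms] .
  define X where "X = (\<alpha> * (exp (- \<theta>) - 1) + \<beta> * (exp \<theta> - 1)) / 2"
  define \<rho> where "\<rho> = - 1 - X"
  have \<rho>: "\<rho> > 0" using \<theta> by (simp add: \<rho>_def X_def)
  \<comment> \<open>Half of the slack \<open>\<rho>\<close> in the exponent pays for margins up to \<open>\<delta> d\<close>, the other half remains in
    the probability.  Each of the five summands of the fluctuation bound gets \<open>\<epsilon> d\<close>; this fixes \<open>\<eta>\<close> and,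
    below, \<open>l\<close> and \<open>k\<close>.  With \<open>R\<^sup>2 = c d\<close> the tail exponent of the integer form is \<open>\<epsilon> n / (8 c) = 25 n\<close>,
    which outweighs \<open>12 n\<close> for the union bound and at most \<open>12 n\<close> for the variance term.\<close>
  define \<delta> where "\<delta> = \<rho> / (2 * \<theta>)"
  \<comment> \<open>a degree above \<open>C d\<close> has probability at most \<open>exp (- C d + 2 \<alpha> d) = 1 / n\<^sup>2\<close>\<close>
  define C where "C = 2 * \<alpha> + 2"
  define \<epsilon> where "\<epsilon> = min (\<delta> / 5) 1"
  define c where "c = \<epsilon> / 200"
  define \<eta> where "\<eta> = \<epsilon> / (2 * C)"
  \<comment> \<open>the failure terms add up to at most \<open>8 = 1 + 3 + 1 + 3\<close> times \<open>n powr (- 2 * \<kappa>)\<close>, and half of the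
    exponent absorbs the constant\<close>
  define \<kappa> where "\<kappa> = min (\<rho> / 2) 1 / 2"
  have \<delta>: "\<delta> > 0" using \<rho> \<theta> by (simp add: \<delta>_def)
  have C: "C > 2" using \<alpha> by (simp add: C_def)
  have \<epsilon>: "0 < \<epsilon>" "\<epsilon> \<le> 1" "5 * \<epsilon> \<le> \<delta>" using \<delta> by (auto simp: \<epsilon>_def)
  have c: "c > 0" using \<epsilon> by (simp add: c_def)
  have \<eta>: "0 < \<eta>" "\<eta> \<le> 1" using \<epsilon> C by (auto simp: \<eta>_def)
  have \<kappa>: "\<kappa> > 0" "2 * \<kappa> \<le> 1" "2 * \<kappa> \<le> \<rho> / 2" using \<rho> by (auto simp: \<kappa>_def)
  have ln_large: "\<forall>\<^sub>F n in sequentially. K \<le> ln (real n)" for K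
  proof -
    have "filterlim (\<lambda>n::nat. ln (real n)) at_top sequentially" by real_asymp
    then show ?thesis by (simp add: filterlim_at_top)
  qed
  have lnln_large: "\<forall>\<^sub>F n in sequentially. K \<le> ln (ln (real n))" for K
  proof -
    have "filterlim (\<lambda>n::nat. ln (ln (real n))) at_top sequentially" by real_asymp
    then show ?thesis by (simp add: filterlim_at_top)
  qed
  have prob_small: "\<forall>\<^sub>F n in sequentially. (\<alpha> + \<beta>) * (ln (real n) / real n) < 1"
  proof -
    have "(\<lambda>n::nat. ln (real n) / real n) \<longlonglongrightarrow> 0" by real_asymp
    then have "(\<lambda>n::nat. (\<alpha> + \<beta>) * (ln (real n) / real n)) \<longlonglongrightarrow> (\<alpha> + \<beta>) * 0"
      by (intro tendsto_intros)
    then show ?thesis by (rule order_tendstoD) simp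
  qed
  have "\<forall>\<^sub>F n in sequentially. \<forall>g. balanced_partition n g \<longrightarrow>
      1 - real n powr (- \<kappa>) \<le> measure_pmf.prob (sbm n (\<alpha> * ln (real n) / real n) (\<beta> * ln (real n) / real n) g)
               {E. sdp_solutions n (adjacency_matrix n E) = {outer_prod g g}}"
    using eventually_gt_at_top[of 0] prob_small ln_large[of 1] ln_large[of "1 / c"]
      ln_large[of "(2 * \<alpha> / \<epsilon>)\<^sup>2 / c"] ln_large[of "\<alpha> / (24 * c\<^sup>2)"] ln_large[of "8 / \<kappa>"]
      lnln_large[of "(\<alpha> / (2 * \<eta>\<^sup>2 * c) + 2) * (2 * C / \<epsilon>\<^sup>2)"]
  proof eventually_elim
    case (elim n)
    define d where "d = ln (real n)"
    note n = elim(1)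
    have d: "d \<ge> 1" "d \<ge> 1 / c" "d \<ge> (2 * \<alpha> / \<epsilon>)\<^sup>2 / c" "d \<ge> \<alpha> / (24 * c\<^sup>2)" "d \<ge> 8 / \<kappa>"
      "ln d \<ge> (\<alpha> / (2 * \<eta>\<^sup>2 * c) + 2) * (2 * C / \<epsilon>\<^sup>2)"
      using elim by (simp_all add: d_def)
    have exp_d: "exp d = n" "exp (- d) = 1 / n" using n by (simp_all add: d_def exp_minus inverse_eq_divide)
    define P where "P = \<alpha> * d / n"
    define q where "q = \<beta> * d / n"
    have Pq: "0 \<le> P" "0 \<le> q" "q \<le> P" "P + q \<le> 1"
    proof -
      show "0 \<le> P" "0 \<le> q" using assms \<alpha> d by (auto simp: P_def q_def)
      show "q \<le> P" unfolding P_def q_def using assms d by (intro divide_right_mono mult_right_mono) auto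
      show "P + q \<le> 1" using elim(2) by (simp add: P_def q_def d_def algebra_simps add_divide_distrib)
    qed
    have Pn: "P * n = \<alpha> * d" using n by (simp add: P_def)
    have qn: "q * n = \<beta> * d" using n by (simp add: q_def)
    define R where "R = sqrt (c * d)"
    have R2: "R\<^sup>2 = c * d" using c d by (simp add: R_def)
    have R1: "R \<ge> 1" using d(2) c by (simp add: R_def field_simps)
    have R: "R \<ge> 2 * \<alpha> / \<epsilon>"
    proof -
      have "(2 * \<alpha> / \<epsilon>)\<^sup>2 \<le> c * d"
        using d(3) unfolding pos_divide_le_eq[OF c] by (simp only: mult.commute)
      then show ?thesis unfolding R_def by (rule real_le_rsqrt)
    qed
    define \<mu> where "\<mu> = 1 / (8 * c * d)"
    show ?case
    proof (intro allI impI)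
      fix g assume g: "balanced_partition n g"
      have "1 - (n * exp (- (C * d) + 2 * P * n) + 3 / n
          + exp (12 * real n - \<mu> * (\<epsilon> * d) * n + 32 * \<mu>\<^sup>2 * P * (real n)\<^sup>2)
          + n * exp (\<theta> * (\<delta> * d) + n / 2 * (P * (exp (- \<theta>) - 1) + q * (exp \<theta> - 1)) + 1))
        \<le> measure_pmf.prob (sbm n P q g) {E. sdp_solutions n (adjacency_matrix n E) = {outer_prod g g}}"
      proof (rule sdp_recovery_probability[where k = "\<epsilon>\<^sup>2 / C * d" and \<eta> = \<eta> and R = R and l = "C / \<epsilon>" and \<phi> = "ln d"])
        show "P * exp (ln d) * n / (2 * (\<eta> * R)\<^sup>2) + 2 * ln n \<le> ln d * (\<epsilon>\<^sup>2 / C * d) / 2"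
        proof -
          have "P * exp (ln d) * n / (2 * (\<eta> * R)\<^sup>2) + 2 * ln n = (\<alpha> / (2 * \<eta>\<^sup>2 * c) + 2) * d"
          proof -
            have "P * exp (ln d) * n / (2 * (\<eta> * R)\<^sup>2) = (P * n) * d / (2 * (\<eta>\<^sup>2 * (c * d)))"
              using d by (simp add: power_mult_distrib R2)
            also have "\<dots> = \<alpha> / (2 * \<eta>\<^sup>2 * c) * d" using d by (simp add: Pn)
            finally show ?thesis by (simp add: d_def algebra_simps)
          qed
          also have "\<dots> = ((\<alpha> / (2 * \<eta>\<^sup>2 * c) + 2) * (2 * C / \<epsilon>\<^sup>2)) * (\<epsilon>\<^sup>2 / C * d / 2)"
            using \<epsilon> C by simp
          also have "\<dots> \<le> ln d * (\<epsilon>\<^sup>2 / C * d / 2)"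
            using d C by (intro mult_right_mono) auto
          finally show ?thesis by simp
        qed
        show "\<epsilon> * d + C / \<epsilon> * (\<epsilon>\<^sup>2 / C * d) + C * d / (C / \<epsilon>) + 2 * \<eta> * (C * d) + 2 * P * n / R \<le> \<delta> * d"
        proof -
          have "C / \<epsilon> * (\<epsilon>\<^sup>2 / C * d) = \<epsilon> * d" "C * d / (C / \<epsilon>) = \<epsilon> * d" "2 * \<eta> * (C * d) = \<epsilon> * d"
            using \<epsilon> C by (simp_all add: \<eta>_def power2_eq_square)
          moreover have "2 * P * n / R \<le> \<epsilon> * d"
          proof -
            have "2 * \<alpha> \<le> \<epsilon> * R" using R \<epsilon> by (simp add: field_simps)
            then have "2 * \<alpha> * d \<le> \<epsilon> * R * d" using d by (intro mult_right_mono) auto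
            then show ?thesis using R1 Pn by (simp add: field_simps)
          qed
          moreover have "5 * \<epsilon> * d \<le> \<delta> * d" using \<epsilon> d by (intro mult_right_mono) auto
          ultimately show ?thesis by linarith
        qed
        show "8 * \<mu> * R\<^sup>2 \<le> 1" using c d by (simp add: \<mu>_def R2)
      qed (use Pq g n R1 \<eta> \<epsilon> C d c \<theta> in \<open>auto simp: \<mu>_def\<close>)
      moreover have "n * exp (- (C * d) + 2 * P * n) \<le> exp (- 2 * \<kappa> * d)"
      proof -
        have "- (C * d) + 2 * P * n = - d + - d"
          using Pn by (simp add: C_def algebra_simps)
        then have "n * exp (- (C * d) + 2 * P * n) = exp (- d)"
          using n by (simp only: exp_add exp_d) simp
        also have "\<dots> \<le> exp (- 2 * \<kappa> * d)"
          using mult_right_mono[OF \<kappa>(2), of d] d by simp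
        finally show ?thesis .
      qed
      moreover have "3 / n \<le> 3 * exp (- 2 * \<kappa> * d)"
      proof -
        have "1 / n \<le> exp (- 2 * \<kappa> * d)"
          using mult_right_mono[OF \<kappa>(2), of d] d unfolding exp_d(2)[symmetric] by simp
        then show ?thesis by simp
      qed
      moreover have "exp (12 * real n - \<mu> * (\<epsilon> * d) * n + 32 * \<mu>\<^sup>2 * P * (real n)\<^sup>2) \<le> exp (- 2 * \<kappa> * d)"
      proof -
        have "\<mu> * (\<epsilon> * d) * n = 25 * n" using \<epsilon> d by (simp add: \<mu>_def c_def)
        moreover have "32 * \<mu>\<^sup>2 * P * (real n)\<^sup>2 = \<alpha> / (2 * c\<^sup>2 * d) * n"
          using n c d by (simp add: \<mu>_def P_def field_simps power2_eq_square)
        moreover have "\<alpha> / (2 * c\<^sup>2 * d) \<le> 12"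
          using d(1,4) c by (simp add: field_simps)
        then have "\<alpha> / (2 * c\<^sup>2 * d) * n \<le> 12 * real n" by (intro mult_right_mono) auto
        moreover have "d \<le> n" using n ln_le_minus_one[of "real n"] by (simp add: d_def)
        moreover have "2 * \<kappa> * d \<le> d" using mult_right_mono[OF \<kappa>(2), of d] d by simp
        ultimately show ?thesis by (subst exp_le_cancel_iff) linarith
      qed
      moreover have "n * exp (\<theta> * (\<delta> * d) + n / 2 * (P * (exp (- \<theta>) - 1) + q * (exp \<theta> - 1)) + 1) \<le> 3 * exp (- 2 * \<kappa> * d)"
      proof -
        have "n / 2 * (P * u + q * v) = (P * n) / 2 * u + (q * n) / 2 * v" for u v
          by (simp add: algebra_simps)
        then have "n / 2 * (P * (exp (- \<theta>) - 1) + q * (exp \<theta> - 1)) = (P * n) / 2 * (exp (- \<theta>) - 1) + (q * n) / 2 * (exp \<theta> - 1)" .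
        also have "\<dots> = X * d" by (simp add: Pn qn X_def field_simps)
        finally have "\<theta> * (\<delta> * d) + n / 2 * (P * (exp (- \<theta>) - 1) + q * (exp \<theta> - 1)) + 1 = \<rho> / 2 * d + X * d + 1"
          using \<theta> by (simp add: \<delta>_def)
        also have "\<dots> = - d + (1 + - (\<rho> / 2 * d))" by (simp add: \<rho>_def algebra_simps)
        finally have "n * exp (\<theta> * (\<delta> * d) + n / 2 * (P * (exp (- \<theta>) - 1) + q * (exp \<theta> - 1)) + 1)
            = exp 1 * exp (- (\<rho> / 2 * d))"
          using n by (simp only: exp_add exp_d) simp
        also have "\<dots> \<le> 3 * exp (- 2 * \<kappa> * d)"
          using mult_right_mono[OF \<kappa>(3), of d] d by (intro mult_mono exp_le) auto
        finally show ?thesis .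
      qed
      moreover have "8 * exp (- 2 * \<kappa> * d) \<le> real n powr (- \<kappa>)"
      proof -
        have "8 \<le> \<kappa> * d" using d(5) \<kappa> by (simp add: field_simps)
        then have "8 \<le> exp (\<kappa> * d)" using exp_ge_add_one_self[of "\<kappa> * d"] by linarith
        then have "8 * exp (- 2 * \<kappa> * d) \<le> exp (\<kappa> * d) * exp (- 2 * \<kappa> * d)" by (intro mult_right_mono) auto
        also have "\<dots> = real n powr (- \<kappa>)" using n by (simp add: powr_def d_def flip: exp_add)
        finally show ?thesis .
      qed
      ultimately show "1 - real n powr (- \<kappa>) \<le> measure_pmf.prob (sbm n (\<alpha> * ln (real n) / real n) (\<beta> * ln (real n) / real n) g)
               {E. sdp_solutions n (adjacency_matrix n E) = {outer_prod g g}}"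
        unfolding P_def q_def d_def by linarith
    qed
  qed
  then show ?thesis
    by (intro exI[of _ \<kappa>] conjI \<kappa>) (auto elim: eventually_mono)
qed

end
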